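(* Let $X$ be a trawl process with trawl function $a$ and homogeneous Lévy basis $L$ on $\mathbb{R}^2$ with Lévy seed $L'$, observed at times $0,\Delta_n,\ldots,(n-1)\Delta_n$. Assume: (i) as $n\uparrow\infty$, $\Delta_n\downarrow0$, $n\Delta_n\to+\infty$, and $n\Delta_n^3\to\mu\in[0,\infty]$; (ii) $a(s)=\int_s^\infty\phi(y)\,dy$ for $s\ge 0$, where $\phi$ is a strictly positive function that is continuous on $[0,\infty)$ and satisfies $\phi(s)=\mathrm{O}(s^{-\alpha-1})$ as $s\to+\infty$ for some $\alpha>1$; (iii) $\mathrm{Var}(L')=1$ and $\mathbb{E}(|L'|^{p_0})<\infty$ for some $p_0>4$. For $t\ge 0$ let $$\hat a'(t)=\frac{1}{n\Delta_n^2}\sum_{k=l+1}^{n-2}\delta_kX\cdot\delta_{k-l-1}X,\qquad\text{if }\Delta_nl\le t<(l+1)\Delta_n,$$ where $\delta_kX=X_{(k+1)\Delta_n}-X_{k\Delta_n}$. Then, for all $t\ge 0$, $$\hat a'(t)=a'(t)+\mathrm{O}_{\mathbb P}\left(1/\sqrt{n\Delta_n^2}\right)+\mathrm{o}(1),\qquad n\to\infty.$$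
   Context: A homogeneous Lévy basis $L$ on $\mathbb{R}^2$ with characteristic triplet $(\gamma,b,\nu)$ is a family of real random variables $L(B)$, indexed by Borel sets $B\subset\mathbb{R}^2$ with $\mathrm{Leb}(B)<\infty$, that is almost surely $\sigma$-additive, has $L(B)$ and $L(C)$ independent for disjoint $B,C$ (independently scattered), each $L(B)$ infinitely divisible, and $\log \mathbb{E}(e^{izL(B)})=\mathrm{Leb}(B)\psi(z)$, where $\psi(z)=i\gamma z-\frac12 b^2z^2+\int_{\mathbb{R}\setminus\{0\}}(e^{izx}-1-izx\mathbf 1_{|x|\le1})\nu(\mathrm{d}x)$, with $\gamma\in\mathbb R$, $b\ge 0$ and $\nu$ a Lévy measure. The Lévy seed $L'$ is an infinitely divisible random variable with $\log\mathbb{E}(e^{izL'})=\psi(z)$. A trawl process: let $a:[0,\infty)\to[0,\infty)$ (the trawl function) be continuous, non-increasing and integrable, let $A=\{(r,y): r\le 0,\ 0\le y\le a(-r)\}$ (the trawl set), $A_t=A+(t,0)$, and $X_t=L(A_t)$, $t\in\mathbb{R}$. Here $a'$ is the derivative of $a$ (right derivative at $0$); $\mathrm{O}_{\mathbb P}(r_n)$ denotes a sequence of random variables which divided by $r_n$ is bounded in probability (tight), and $\mathrm{o}(1)$ a deterministic sequence tending to $0$. *)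

theory Defs
  imports "HOL-Probability.Probability" "HOL-Library.Landau_Symbols"
begin

definition levy_measure :: "real measure \<Rightarrow> bool" where
  "levy_measure \<nu> \<longleftrightarrow> sets \<nu> = sets borel \<and> emeasure \<nu> {0} = 0 \<and>
     (\<integral>\<^sup>+x. ennreal (min 1 (x\<^sup>2)) \<partial>\<nu>) < \<infinity>"

definition levy_exponent :: "real \<Rightarrow> real \<Rightarrow> real measure \<Rightarrow> real \<Rightarrow> complex" where
  "levy_exponent \<gamma> b \<nu> z =
     \<i> * of_real (\<gamma> * z) - of_real (b\<^sup>2 * z\<^sup>2 / 2) +
     set_lebesgue_integral \<nu> (-{0})
       (\<lambda>x. exp (\<i> * of_real (z * x)) - 1 - \<i> * of_real (z * x) * of_bool (\<bar>x\<bar> \<le> 1))"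

(* convolution N ^^ n applied to the unit mass at 0 is the n-fold convolution power of N *)
definition infinitely_divisible :: "real measure \<Rightarrow> bool" where
  "infinitely_divisible D \<longleftrightarrow> real_distribution D \<and>
     (\<forall>n\<ge>1. \<exists>N. real_distribution N \<and> D = (convolution N ^^ n) (return borel 0))"

definition finite_area :: "(real \<times> real) set \<Rightarrow> bool" where
  "finite_area B \<longleftrightarrow> B \<in> sets borel \<and> emeasure lborel B < \<infinity>"

(* The characteristic function of an infinitely divisible law never vanishes, and its logarithm is
   the continuous one that is 0 at 0. As levy_exponent is continuous with value 0 at 0, the
   identity "log E exp(i z L(B)) = Leb(B) psi(z) for all z" is the exponentiated identity below.
   Independent scattering is mutual independence over countable disjoint families; finite
   families are covered because empty sets may be repeated. *)
locale homogeneous_levy_basis = prob_space M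
  for M :: "'a measure" and L :: "(real \<times> real) set \<Rightarrow> 'a \<Rightarrow> real"
    and \<gamma> b :: real and \<nu> :: "real measure" +
  assumes b_nonneg: "b \<ge> 0"
    and levy_measure: "levy_measure \<nu>"
    and measurable_basis: "\<And>B. finite_area B \<Longrightarrow> L B \<in> borel_measurable M"
    and sigma_additive: "\<And>B :: nat \<Rightarrow> (real \<times> real) set.
        (\<And>i. finite_area (B i)) \<Longrightarrow> disjoint_family B \<Longrightarrow> finite_area (\<Union>i. B i) \<Longrightarrow>
        AE \<omega> in M. (\<lambda>i. L (B i) \<omega>) sums L (\<Union>i. B i) \<omega>"
    and independently_scattered: "\<And>B :: nat \<Rightarrow> (real \<times> real) set.
        (\<And>i. finite_area (B i)) \<Longrightarrow> disjoint_family B \<Longrightarrow>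
        indep_vars (\<lambda>_. borel) (\<lambda>i. L (B i)) UNIV"
    and infinitely_divisible_basis:
        "\<And>B. finite_area B \<Longrightarrow> infinitely_divisible (distr M borel (L B))"
    and char_basis: "\<And>B z. finite_area B \<Longrightarrow>
        char (distr M borel (L B)) z = exp (of_real (measure lborel B) * levy_exponent \<gamma> b \<nu> z)"

locale levy_seed = prob_space N
  for N :: "'b measure" and L' :: "'b \<Rightarrow> real" and \<gamma> b :: real and \<nu> :: "real measure" +
  assumes measurable_seed: "L' \<in> borel_measurable N"
    and infinitely_divisible_seed: "infinitely_divisible (distr N borel L')"
    and char_seed: "\<And>z. char (distr N borel L') z = exp (levy_exponent \<gamma> b \<nu> z)"

(* Only the values of a on the half-line s >= 0 matter. *)
definition trawl_function :: "(real \<Rightarrow> real) \<Rightarrow> bool" where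
  "trawl_function a \<longleftrightarrow> (\<forall>s\<ge>0. a s \<ge> 0) \<and> continuous_on {0..} a \<and> antimono_on {0..} a \<and>
     set_integrable lborel {0..} a"

definition trawl_set :: "(real \<Rightarrow> real) \<Rightarrow> (real \<times> real) set" where
  "trawl_set a = {(r, y). r \<le> 0 \<and> 0 \<le> y \<and> y \<le> a (- r)}"

definition trawl_process ::
    "(real \<Rightarrow> real) \<Rightarrow> ((real \<times> real) set \<Rightarrow> 'a \<Rightarrow> real) \<Rightarrow> real \<Rightarrow> 'a \<Rightarrow> real" where
  "trawl_process a L t = L ((\<lambda>p. p + (t, 0)) ` trawl_set a)"

definition increment :: "(real \<Rightarrow> 'a \<Rightarrow> real) \<Rightarrow> real \<Rightarrow> nat \<Rightarrow> 'a \<Rightarrow> real" where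
  "increment X d k \<omega> = X (real (k + 1) * d) \<omega> - X (real k * d) \<omega>"

definition lag :: "real \<Rightarrow> real \<Rightarrow> nat" where
  "lag d t = (THE l. d * real l \<le> t \<and> t < real (l + 1) * d)"

lemma lag_eqI:
  assumes "d > 0" "d * real l \<le> t" "t < real (l + 1) * d"
  shows "lag d t = l"
  unfolding lag_def
proof (rule the_equality)
  show "d * real l \<le> t \<and> t < real (l + 1) * d" using assms by simp
next
  fix m assume m: "d * real m \<le> t \<and> t < real (m + 1) * d"
  have "d * real m < d * real (l + 1)" "d * real l < d * real (m + 1)"
    using m assms(2,3) by (metis le_less_trans mult.commute)+
  then have "real m < real (l + 1)" "real l < real (m + 1)"
    using assms(1) mult_less_cancel_left_pos by blast+
  then show "m = l" by linarith
qed

lemma lag_eq_floor: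
  assumes "d > 0" "t \<ge> 0"
  shows "lag d t = nat \<lfloor>t / d\<rfloor>"
proof (rule lag_eqI[OF assms(1)])
  have r: "real (nat \<lfloor>t / d\<rfloor>) = of_int \<lfloor>t / d\<rfloor>" using assms by simp
  have "of_int \<lfloor>t / d\<rfloor> \<le> t / d" by linarith
  then show "d * real (nat \<lfloor>t / d\<rfloor>) \<le> t"
    unfolding r using assms(1) by (simp only: pos_le_divide_eq mult.commute)
  have "t / d < of_int \<lfloor>t / d\<rfloor> + 1" by linarith
  then show "t < real (nat \<lfloor>t / d\<rfloor> + 1) * d"
    unfolding of_nat_add r using assms(1) by (simp only: pos_divide_less_eq of_nat_1)
qed

(* For n < 2 the natural-number bound n - 2 is 0 and the sum is empty, as it should be. *)
definition trawl_deriv_estimator ::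
    "(real \<Rightarrow> 'a \<Rightarrow> real) \<Rightarrow> nat \<Rightarrow> real \<Rightarrow> real \<Rightarrow> 'a \<Rightarrow> real" where
  "trawl_deriv_estimator X n d t \<omega> =
     1 / (real n * d\<^sup>2) *
     (\<Sum>k = lag d t + 1..n - 2. increment X d k \<omega> * increment X d (k - lag d t - 1) \<omega>)"

definition O_prob :: "'a measure \<Rightarrow> (nat \<Rightarrow> 'a \<Rightarrow> real) \<Rightarrow> (nat \<Rightarrow> real) \<Rightarrow> bool" where
  "O_prob M Y r \<longleftrightarrow> (\<forall>n. Y n \<in> borel_measurable M) \<and>
     tight (\<lambda>n. distr M borel (\<lambda>\<omega>. Y n \<omega> / r n))"

end

theory Submission
  imports Defs
begin

text \<open>Write \<open>A k\<close> for the trawl set at time \<open>k \<Delta>\<close>. The estimator is a normalised sum of products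
of increments \<open>L (A (k + 1)) - L (A k)\<close> at distance \<open>l + 1\<close> grid steps. It equals its
expectation plus a centred remainder. The expectation converges to \<open>a' t\<close>, and the remainder,
multiplied by \<open>sqrt (n \<Delta>\<^sup>2)\<close>, has a bounded second moment and is therefore tight.

Expectation. The increments are centred, as all trawl sets have the same area. Two trawl sets at
distance \<open>h\<close> have in common the area \<open>G h\<close>, the integral of \<open>a\<close> over \<open>{h..}\<close>, so the
covariance of the two increments is minus a second difference of \<open>G\<close> with step \<open>\<Delta>\<close> near
\<open>t\<close>. Since \<open>G' = - a\<close> and \<open>a' = - \<phi>\<close>, the mean value theorem
(\<open>second_difference_mean_value\<close>) makes it \<open>- \<Delta>\<^sup>2 \<phi> \<xi>\<close> with \<open>\<xi>\<close> close to
\<open>t\<close>.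

Variance. The trawl sets on the grid cut the plane into disjoint cells, on which \<open>L\<close> takes
independent values. In terms of these the sum is a quadratic form, whose variance is bounded by
\<open>quadratic_form_moments\<close> through squared coefficients, fourth moments of cells on the diagonal and
products of variances off it. Monotonicity of \<open>a\<close> makes a point of the plane enter the moving
trawl set once and leave it once, so the coefficients are at most 2 in absolute value. This gives
two contributions for each of the at most \<open>n\<close> summands (\<open>increment_products\<close>): the squared area
swept in one step, of order \<open>\<Delta>\<^sup>2\<close>, and the area of the points that enter in the one step and
leave in the other, which is the second difference above and of order \<open>\<Delta>\<^sup>2\<close> as well.

Moments of cells. The law of \<open>L B\<close> depends only on the area of \<open>B\<close>. Variance and fourth cumulant
add over disjoint sets, so they are additive functions of the area with a lower bound near 0, hence linear
(\<open>linear_of_additive_bounded_below\<close>), and the slopes are those of the seed. In particular the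
fourth central moment of a cell is at most a constant times its area.\<close>

section \<open>Additive functions on the half-line\<close>

text \<open>Boundedness below on the unit interval rules out the wild solutions of Cauchy's equation: after
subtracting the linear part, the function has period 1 and is bounded below on the whole half-line.
By additivity a negative value at \<open>x\<close> would multiply without bound along \<open>n x\<close>, so the
function is nonnegative; since its values at \<open>x\<close> and \<open>n - x\<close> add up to zero, it vanishes.\<close>
lemma linear_of_additive_bounded_below:
  fixes f :: "real \<Rightarrow> real"
  assumes add: "\<And>x y. x \<ge> 0 \<Longrightarrow> y \<ge> 0 \<Longrightarrow> f (x + y) = f x + f y"
    and bdd: "\<And>x. 0 \<le> x \<Longrightarrow> x \<le> 1 \<Longrightarrow> f x \<ge> - C"
    and x: "x \<ge> 0"
  shows "f x = f 1 * x"
proof -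
  define g where "g x = f x - f 1 * x" for x
  have gadd: "g (x + y) = g x + g y" if "x \<ge> 0" "y \<ge> 0" for x y
    using add[OF that] by (simp add: g_def algebra_simps)
  have gmult: "g (real n * x) = real n * g x" if "x \<ge> 0" for n x
  proof (induction n)
    case 0
    show ?case using gadd[of 0 0] by simp
  next
    case (Suc n)
    then show ?case using gadd[of "real n * x" x] that by (simp add: algebra_simps)
  qed
  have g1: "g 1 = 0" by (simp add: g_def)
  define C' where "C' = \<bar>C\<bar> + \<bar>f 1\<bar>"
  have g_ge: "g x \<ge> - C'" if "x \<ge> 0" for x
  proof -
    define k where "k = nat \<lfloor>x\<rfloor>"
    have k: "real k \<le> x" "x - real k \<le> 1" using that unfolding k_def by linarith+
    have "g (real k * 1 + (x - real k)) = real k * g 1 + g (x - real k)"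
      using gadd[of "real k * 1" "x - real k"] gmult[of 1 k] k by simp
    then have "g x = g (x - real k)" using g1 by simp
    moreover have "\<bar>f 1 * (x - real k)\<bar> \<le> \<bar>f 1\<bar>"
      using k by (simp add: abs_mult mult_left_le)
    moreover have "f (x - real k) \<ge> - C" using bdd k by simp
    ultimately show ?thesis unfolding g_def C'_def by linarith
  qed
  have g_nonneg: "g x \<ge> 0" if "x \<ge> 0" for x
  proof (rule ccontr)
    assume "\<not> g x \<ge> 0"
    then obtain n :: nat where "real n * (- g x) > C'"
      using reals_Archimedean3[of "- g x"] by auto
    moreover have "real n * g x \<ge> - C'"
      using g_ge[of "real n * x"] gmult[OF that] that by simp
    ultimately show False by simp
  qed
  obtain n :: nat where n: "x \<le> real n" using real_arch_simple by blast
  have "g (x + (real n - x)) = g x + g (real n - x)" using gadd[of x "real n - x"] x n by simp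
  moreover have "g (real n) = 0" using gmult[of 1 n] g1 by simp
  ultimately have "g x = 0" using g_nonneg[of x] g_nonneg[of "real n - x"] x n by simp
  then show ?thesis by (simp add: g_def)
qed

text \<open>The algebra behind the additivity of the fourth cumulant: the mixed term of the fourth moment of a
sum is what the square of the summed variances contributes.\<close>
lemma fourth_cumulant_identity:
  fixes a b c d :: real
  shows "a + 6 * (b * c) + d - 3 * (b + c)\<^sup>2 = (a - 3 * b\<^sup>2) + (d - 3 * c\<^sup>2)"
  by (simp add: power2_eq_square algebra_simps)

section \<open>Moments of sums and quadratic forms of independent variables\<close>

context prob_space
begin

text \<open>Reindexing is a special case of grouping the variables into blocks, here into singletons.\<close>
lemma indep_vars_reindex_inj:
  assumes ind: "indep_vars (\<lambda>_. N) X I" and f: "inj_on f J" "f ` J \<subseteq> I"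
  shows "indep_vars (\<lambda>_. N) (\<lambda>j. X (f j)) J"
proof -
  have "indep_vars (\<lambda>j. PiM {f j} (\<lambda>_. N)) (\<lambda>j \<omega>. restrict (\<lambda>i. X i \<omega>) {f j}) J"
    using f by (intro indep_vars_restrict[OF ind]) (auto simp: disjoint_family_on_def inj_on_def)
  from indep_vars_compose2[OF this, of "\<lambda>j h. h (f j)" "\<lambda>_. N"]
  show ?thesis by simp
qed

lemma indep_var_compose_real:
  assumes "indep_var borel X borel Y" "f \<in> borel_measurable borel" "g \<in> borel_measurable borel"
  shows "indep_var borel (\<lambda>\<omega>. f (X \<omega>) :: real) borel (\<lambda>\<omega>. g (Y \<omega>) :: real)"
  using indep_var_compose[OF assms] by (simp add: comp_def)

lemma integrable_power_le_four:
  fixes X :: "'a \<Rightarrow> real"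
  assumes X: "X \<in> borel_measurable M" and int: "integrable M (\<lambda>\<omega>. X \<omega> ^ 4)" and k: "k \<le> 4"
  shows "integrable M (\<lambda>\<omega>. X \<omega> ^ k)"
proof (rule Bochner_Integration.integrable_bound)
  show "integrable M (\<lambda>\<omega>. 1 + X \<omega> ^ 4)" using int by simp
  show "(\<lambda>\<omega>. X \<omega> ^ k) \<in> borel_measurable M" using X by simp
  have "\<bar>x ^ k\<bar> \<le> 1 + x ^ 4" for x :: real
  proof (cases "\<bar>x\<bar> \<le> 1")
    case True
    then show ?thesis using power_le_one[of "\<bar>x\<bar>" k] by (simp add: power_abs add_increasing2)
  next
    case False
    then show ?thesis using power_increasing[of k 4 "\<bar>x\<bar>"] k by (simp add: power_abs)
  qed
  moreover have "0 \<le> 1 + x ^ 4" for x :: real by (simp add: add_nonneg_nonneg)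
  ultimately show "AE \<omega> in M. norm (X \<omega> ^ k) \<le> norm (1 + X \<omega> ^ 4)" by simp
qed

lemma integrable_shift_power_four:
  fixes X :: "'a \<Rightarrow> real"
  assumes X: "X \<in> borel_measurable M" and int: "integrable M (\<lambda>\<omega>. X \<omega> ^ 4)" and k: "k \<le> 4"
  shows "integrable M (\<lambda>\<omega>. (X \<omega> + c) ^ k)"
  unfolding binomial_ring
  using k by (intro Bochner_Integration.integrable_sum integrable_mult_left integrable_mult_right
     integrable_power_le_four[OF X int]) auto

lemma integrable_mult_of_square_integrable:
  fixes f g :: "'a \<Rightarrow> real"
  assumes m: "f \<in> borel_measurable M" "g \<in> borel_measurable M"
    and "integrable M (\<lambda>x. (f x)\<^sup>2)" "integrable M (\<lambda>x. (g x)\<^sup>2)"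
  shows "integrable M (\<lambda>x. f x * g x)"
proof (rule Bochner_Integration.integrable_bound)
  show "integrable M (\<lambda>x. (f x)\<^sup>2 + (g x)\<^sup>2)" using assms by simp
  show "(\<lambda>x. f x * g x) \<in> borel_measurable M" using m by simp
  have "\<bar>a * b\<bar> \<le> a\<^sup>2 + b\<^sup>2" for a b :: real
  proof -
    have "2 * \<bar>a * b\<bar> \<le> a\<^sup>2 + b\<^sup>2"
      using sum_squares_bound[of "\<bar>a\<bar>" "\<bar>b\<bar>"] by (simp add: abs_mult)
    moreover have "0 \<le> a\<^sup>2 + b\<^sup>2" by simp
    ultimately show ?thesis by linarith
  qed
  then show "AE x in M. norm (f x * g x) \<le> norm ((f x)\<^sup>2 + (g x)\<^sup>2)" by simp
qed

text \<open>By Fubini's theorem, almost every translate \<open>x + Y\<close> has a finite fourth moment, and one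
translate is enough for \<open>Y\<close> itself.\<close>
lemma integrable_power_four_summand:
  fixes X Y :: "'a \<Rightarrow> real"
  assumes ind: "indep_var borel X borel Y" and int: "integrable M (\<lambda>\<omega>. (X \<omega> + Y \<omega>) ^ 4)"
  shows "integrable M (\<lambda>\<omega>. Y \<omega> ^ 4)"
proof -
  have X: "X \<in> borel_measurable M" and Y: "Y \<in> borel_measurable M"
    using indep_var_rv1[OF ind] indep_var_rv2[OF ind] by auto
  interpret PX: prob_space "distr M borel X" by (rule prob_space_distr[OF X])
  interpret PY: prob_space "distr M borel Y" by (rule prob_space_distr[OF Y])
  interpret P: pair_sigma_finite "distr M borel X" "distr M borel Y" ..
  have "distr M borel X \<Otimes>\<^sub>M distr M borel Y
      = distr M (borel \<Otimes>\<^sub>M borel) (\<lambda>\<omega>. (X \<omega>, Y \<omega>))"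
    using ind by (simp only: indep_var_distribution_eq)
  moreover have "integrable (distr M (borel \<Otimes>\<^sub>M borel) (\<lambda>\<omega>. (X \<omega>, Y \<omega>)))
      (\<lambda>p. (fst p + snd p) ^ 4)"
    using int X Y by (subst integrable_distr_eq) auto
  ultimately have "integrable (distr M borel X \<Otimes>\<^sub>M distr M borel Y) (\<lambda>p. (fst p + snd p) ^ 4)"
    by (simp only:)
  from P.AE_integrable_fst'[OF this]
  have ae: "AE x in distr M borel X. integrable (distr M borel Y) (\<lambda>y. (y + x) ^ 4)"
    by (simp add: add.commute)
  obtain x where x: "integrable (distr M borel Y) (\<lambda>y. (y + x) ^ 4)"
  proof (rule ccontr)
    assume "\<not> thesis"
    then have "\<not> integrable (distr M borel Y) (\<lambda>y. (y + x) ^ 4)" for x using that by blast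
    with ae have "AE x in distr M borel X. False" by simp
    then show False by (simp only: PX.AE_False)
  qed
  from PY.integrable_shift_power_four[OF _ x, of 4 "- x"]
  have "integrable (distr M borel Y) (\<lambda>y. y ^ 4)" by simp
  then show ?thesis using Y by (subst (asm) integrable_distr_eq) auto
qed

definition fourth_cumulant :: "('a \<Rightarrow> real) \<Rightarrow> real" where
  "fourth_cumulant X = expectation (\<lambda>\<omega>. (X \<omega> - expectation X) ^ 4) - 3 * (variance X)\<^sup>2"

lemma
  fixes X Y :: "'a \<Rightarrow> real"
  assumes ind: "indep_var borel X borel Y"
    and intX: "integrable M (\<lambda>\<omega>. X \<omega> ^ 4)" and intY: "integrable M (\<lambda>\<omega>. Y \<omega> ^ 4)"
  shows integrable_power_four_add: "integrable M (\<lambda>\<omega>. (X \<omega> + Y \<omega>) ^ 4)"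
    and variance_add: "variance (\<lambda>\<omega>. X \<omega> + Y \<omega>) = variance X + variance Y"
    and fourth_cumulant_add:
      "fourth_cumulant (\<lambda>\<omega>. X \<omega> + Y \<omega>) = fourth_cumulant X + fourth_cumulant Y"
proof -
  have X: "X \<in> borel_measurable M" and Y: "Y \<in> borel_measurable M"
    using indep_var_rv1[OF ind] indep_var_rv2[OF ind] by auto
  have X1: "integrable M X" using integrable_power_le_four[OF X intX, of 1] by simp
  have Y1: "integrable M Y" using integrable_power_le_four[OF Y intY, of 1] by simp
  define U where "U \<omega> = X \<omega> - expectation X" for \<omega>
  define V where "V \<omega> = Y \<omega> - expectation Y" for \<omega>
  have Ui: "integrable M (\<lambda>\<omega>. U \<omega> ^ k)" and Vi: "integrable M (\<lambda>\<omega>. V \<omega> ^ k)" if "k \<le> 4" for k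
    using integrable_shift_power_four[OF X intX that, of "- expectation X"]
      integrable_shift_power_four[OF Y intY that, of "- expectation Y"]
    by (simp_all add: U_def V_def)
  have EU: "expectation U = 0" "expectation V = 0"
    using X1 Y1 by (simp_all add: U_def[abs_def] V_def[abs_def] prob_space)
  have prod: "integrable M (\<lambda>\<omega>. U \<omega> ^ i * V \<omega> ^ j)"
      "expectation (\<lambda>\<omega>. U \<omega> ^ i * V \<omega> ^ j) = expectation (\<lambda>\<omega>. U \<omega> ^ i) * expectation (\<lambda>\<omega>. V \<omega> ^ j)"
    if "i \<le> 4" "j \<le> 4" for i j
  proof -
    have "indep_var borel (\<lambda>\<omega>. U \<omega> ^ i) borel (\<lambda>\<omega>. V \<omega> ^ j)"
      unfolding U_def V_def by (rule indep_var_compose_real[OF ind]) auto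
    from indep_var_integrable[OF this Ui[OF that(1)] Vi[OF that(2)]]
      indep_var_lebesgue_integral[OF this Ui[OF that(1)] Vi[OF that(2)]]
    show "integrable M (\<lambda>\<omega>. U \<omega> ^ i * V \<omega> ^ j)"
      "expectation (\<lambda>\<omega>. U \<omega> ^ i * V \<omega> ^ j) = expectation (\<lambda>\<omega>. U \<omega> ^ i) * expectation (\<lambda>\<omega>. V \<omega> ^ j)" .
  qed
  have four: "(u + v) ^ 4 = u ^ 4 * v ^ 0 + 4 * (u ^ 3 * v ^ 1) + 6 * (u ^ 2 * v ^ 2)
      + 4 * (u ^ 1 * v ^ 3) + u ^ 0 * v ^ 4" for u v :: real
    by (simp add: power4_eq_xxxx power3_eq_cube power2_eq_square algebra_simps)
  have two: "(u + v) ^ 2 = u ^ 2 * v ^ 0 + 2 * (u ^ 1 * v ^ 1) + u ^ 0 * v ^ 2" for u v :: real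
    by (simp add: power2_eq_square algebra_simps)
  have int4: "integrable M (\<lambda>\<omega>. (U \<omega> + V \<omega>) ^ 4)"
    unfolding four by (intro Bochner_Integration.integrable_add integrable_mult_right prod) auto
  have meas: "U \<in> borel_measurable M" "V \<in> borel_measurable M"
    using X Y by (simp_all add: U_def[abs_def] V_def[abs_def])
  have UV: "(\<lambda>\<omega>. U \<omega> + V \<omega> + (expectation X + expectation Y)) = (\<lambda>\<omega>. X \<omega> + Y \<omega>)"
    by (simp add: U_def V_def)
  show "integrable M (\<lambda>\<omega>. (X \<omega> + Y \<omega>) ^ 4)"
    using integrable_shift_power_four[OF _ int4, of 4 "expectation X + expectation Y"] meas X Y
    by (simp add: U_def V_def)
  have cen: "X \<omega> + Y \<omega> - expectation (\<lambda>\<omega>. X \<omega> + Y \<omega>) = U \<omega> + V \<omega>" for \<omega>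
    using X1 Y1 by (simp add: U_def V_def)
  let ?u = "\<lambda>i. expectation (\<lambda>\<omega>. U \<omega> ^ i)" and ?v = "\<lambda>i. expectation (\<lambda>\<omega>. V \<omega> ^ i)"
  have hb: "has_bochner_integral M (\<lambda>\<omega>. U \<omega> ^ i * V \<omega> ^ j) (?u i * ?v j)"
    if "i \<le> 4" "j \<le> 4" for i j
    using prod[OF that] by (simp add: has_bochner_integral_iff)
  have "has_bochner_integral M (\<lambda>\<omega>. (U \<omega> + V \<omega>) ^ 2)
      (?u 2 * ?v 0 + 2 * (?u 1 * ?v 1) + ?u 0 * ?v 2)"
    unfolding two
    by (intro has_bochner_integral_add has_bochner_integral_mult_right hb) auto
  then have v2: "expectation (\<lambda>\<omega>. (U \<omega> + V \<omega>) ^ 2) = ?u 2 + ?v 2"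
    by (simp add: has_bochner_integral_iff EU prob_space)
  have "has_bochner_integral M (\<lambda>\<omega>. (U \<omega> + V \<omega>) ^ 4)
      (?u 4 * ?v 0 + 4 * (?u 3 * ?v 1) + 6 * (?u 2 * ?v 2) + 4 * (?u 1 * ?v 3) + ?u 0 * ?v 4)"
    unfolding four
    by (intro has_bochner_integral_add has_bochner_integral_mult_right hb) auto
  then have v4: "expectation (\<lambda>\<omega>. (U \<omega> + V \<omega>) ^ 4) = ?u 4 + 6 * (?u 2 * ?v 2) + ?v 4"
    by (simp add: has_bochner_integral_iff EU prob_space)
  have centred_moments: "expectation (\<lambda>\<omega>. (X \<omega> - expectation X) ^ k) = ?u k"
      "expectation (\<lambda>\<omega>. (Y \<omega> - expectation Y) ^ k) = ?v k" for k
    by (simp_all only: U_def V_def)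
  show "variance (\<lambda>\<omega>. X \<omega> + Y \<omega>) = variance X + variance Y"
    by (simp only: cen v2 centred_moments)
  have "?u 4 + 6 * (?u 2 * ?v 2) + ?v 4 - 3 * (?u 2 + ?v 2)\<^sup>2
      = (?u 4 - 3 * (?u 2)\<^sup>2) + (?v 4 - 3 * (?v 2)\<^sup>2)"
    by (rule fourth_cumulant_identity)
  then show "fourth_cumulant (\<lambda>\<omega>. X \<omega> + Y \<omega>) = fourth_cumulant X + fourth_cumulant Y"
    by (simp only: fourth_cumulant_def cen v2 v4 centred_moments)
qed

lemma indep_var_insert:
  fixes W :: "'i \<Rightarrow> 'a \<Rightarrow> real"
  assumes "indep_vars (\<lambda>_. borel) W (insert x F)" "x \<notin> F"
    and f: "f \<in> borel_measurable borel" and g: "g \<in> borel_measurable (PiM F (\<lambda>_. borel))"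
  shows "indep_var borel (\<lambda>\<omega>. f (W x \<omega>) :: real) borel (\<lambda>\<omega>. g (\<lambda>i\<in>F. W i \<omega>) :: real)"
proof -
  have "indep_var (PiM {x} (\<lambda>_. borel)) (\<lambda>\<omega>. \<lambda>i\<in>{x}. W i \<omega>)
      (PiM F (\<lambda>_. borel)) (\<lambda>\<omega>. \<lambda>i\<in>F. W i \<omega>)"
    using assms(2) by (intro indep_var_restrict[OF assms(1)]) auto
  from indep_var_compose[OF this, of "\<lambda>h. f (h x)" borel g borel] f g
  show ?thesis by (simp add: comp_def)
qed

lemma has_bochner_integral_indep_mult:
  fixes X Y :: "'a \<Rightarrow> real"
  assumes "indep_var borel X borel Y" "has_bochner_integral M X x" "has_bochner_integral M Y y"
  shows "has_bochner_integral M (\<lambda>\<omega>. X \<omega> * Y \<omega>) (x * y)"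
  using indep_var_integrable[OF assms(1)] indep_var_lebesgue_integral[OF assms(1)] assms(2,3)
  by (simp add: has_bochner_integral_iff)

lemma linear_form_moments:
  fixes W :: "'i \<Rightarrow> 'a \<Rightarrow> real"
  assumes "finite F" "indep_vars (\<lambda>_. borel) W F"
    and "\<And>c. c \<in> F \<Longrightarrow> has_bochner_integral M (W c) 0"
    and "\<And>c. c \<in> F \<Longrightarrow> has_bochner_integral M (\<lambda>\<omega>. (W c \<omega>)\<^sup>2) (s c)"
  shows "has_bochner_integral M (\<lambda>\<omega>. \<Sum>c\<in>F. b c * W c \<omega>) 0"
    and "has_bochner_integral M (\<lambda>\<omega>. (\<Sum>c\<in>F. b c * W c \<omega>)\<^sup>2) (\<Sum>c\<in>F. (b c)\<^sup>2 * s c)"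
proof -
  have "has_bochner_integral M (\<lambda>\<omega>. \<Sum>c\<in>F. b c * W c \<omega>) (\<Sum>c\<in>F. b c * 0)"
    using assms by (intro has_bochner_integral_sum has_bochner_integral_mult_right) auto
  then show lin: "has_bochner_integral M (\<lambda>\<omega>. \<Sum>c\<in>F. b c * W c \<omega>) 0" by simp
  from assms
  show "has_bochner_integral M (\<lambda>\<omega>. (\<Sum>c\<in>F. b c * W c \<omega>)\<^sup>2) (\<Sum>c\<in>F. (b c)\<^sup>2 * s c)"
  proof (induction F)
    case empty
    show ?case by (simp add: has_bochner_integral_iff)
  next
    case (insert x F)
    let ?Z = "\<lambda>\<omega>. \<Sum>c\<in>F. b c * W c \<omega>"
    have Z2: "has_bochner_integral M (\<lambda>\<omega>. (?Z \<omega>)\<^sup>2) (\<Sum>c\<in>F. (b c)\<^sup>2 * s c)"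
      using insert.prems by (intro insert.IH) (auto intro: indep_vars_subset)
    have "has_bochner_integral M ?Z (\<Sum>c\<in>F. b c * 0)"
      using insert.prems by (intro has_bochner_integral_sum has_bochner_integral_mult_right) auto
    then have Z: "has_bochner_integral M ?Z 0" by simp
    have meas: "(\<lambda>h. \<Sum>c\<in>F. b c * h c) \<in> borel_measurable (PiM F (\<lambda>_. borel))" by simp
    have "indep_var borel (\<lambda>\<omega>. W x \<omega>) borel (\<lambda>\<omega>. (\<lambda>h. \<Sum>c\<in>F. b c * h c) (\<lambda>i\<in>F. W i \<omega>))"
      using insert by (intro indep_var_insert[of W x F "\<lambda>w. w"] meas) auto
    then have "indep_var borel (W x) borel ?Z" by simp
    from has_bochner_integral_indep_mult[OF this insert.prems(2) Z]
    have WZ: "has_bochner_integral M (\<lambda>\<omega>. W x \<omega> * ?Z \<omega>) (0 * 0)" by simp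
    have "has_bochner_integral M
      (\<lambda>\<omega>. (b x)\<^sup>2 * (W x \<omega>)\<^sup>2 + 2 * b x * (W x \<omega> * ?Z \<omega>) + (?Z \<omega>)\<^sup>2)
      ((b x)\<^sup>2 * s x + 2 * b x * (0 * 0) + (\<Sum>c\<in>F. (b c)\<^sup>2 * s c))"
      using insert.prems
      by (intro has_bochner_integral_add has_bochner_integral_mult_right WZ Z2) auto
    also have "(\<lambda>\<omega>. (b x)\<^sup>2 * (W x \<omega>)\<^sup>2 + 2 * b x * (W x \<omega> * ?Z \<omega>) + (?Z \<omega>)\<^sup>2)
      = (\<lambda>\<omega>. (\<Sum>c\<in>insert x F. b c * W c \<omega>)\<^sup>2)"
      using insert.hyps by (simp add: power2_eq_square algebra_simps)
    finally show ?case using insert.hyps by simp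
  qed
qed

text \<open>The centred quadratic form in independent centred variables is built up one variable at a time.
Adding the variable \<open>x\<close> adds two terms: a product of \<open>W x\<close> with a linear form in the earlier
variables, and a multiple of \<open>(W x)\<^sup>2 - s x\<close>. Up to factors of mean zero, both are independent of
the earlier part, so all mixed expectations vanish and the second moments add up. The symmetrised
coefficient \<open>q x c + q c x\<close> of the linear form is where the factor 2 in the bound comes from.\<close>
lemma quadratic_form_moments:
  fixes W :: "'i \<Rightarrow> 'a \<Rightarrow> real" and q :: "'i \<Rightarrow> 'i \<Rightarrow> real" and s :: "'i \<Rightarrow> real"
  defines "H \<equiv> \<lambda>F \<omega>. (\<Sum>c\<in>F. \<Sum>d\<in>F. q c d * (W c \<omega> * W d \<omega>)) - (\<Sum>c\<in>F. q c c * s c)"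
  assumes "finite F" "indep_vars (\<lambda>_. borel) W F"
    and "\<And>c. c \<in> F \<Longrightarrow> has_bochner_integral M (W c) 0"
    and "\<And>c. c \<in> F \<Longrightarrow> has_bochner_integral M (\<lambda>\<omega>. (W c \<omega>)\<^sup>2) (s c)"
    and "\<And>c. c \<in> F \<Longrightarrow> integrable M (\<lambda>\<omega>. W c \<omega> ^ 4)"
  shows quadratic_form_mean: "has_bochner_integral M (H F) 0"
    and quadratic_form_square_integrable: "integrable M (\<lambda>\<omega>. (H F \<omega>)\<^sup>2)"
    and quadratic_form_variance_bound: "expectation (\<lambda>\<omega>. (H F \<omega>)\<^sup>2) \<le>
      (\<Sum>c\<in>F. (q c c)\<^sup>2 * expectation (\<lambda>\<omega>. W c \<omega> ^ 4))
      + 2 * (\<Sum>c\<in>F. \<Sum>d\<in>F. (q c d)\<^sup>2 * (s c * s d))"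
proof -
  have "has_bochner_integral M (H F) 0 \<and> integrable M (\<lambda>\<omega>. (H F \<omega>)\<^sup>2) \<and>
    expectation (\<lambda>\<omega>. (H F \<omega>)\<^sup>2) \<le> (\<Sum>c\<in>F. (q c c)\<^sup>2 * expectation (\<lambda>\<omega>. W c \<omega> ^ 4))
      + 2 * (\<Sum>c\<in>F. \<Sum>d\<in>F. (q c d)\<^sup>2 * (s c * s d))"
    using assms(2-)
  proof (induction F)
    case empty
    show ?case by (simp add: H_def has_bochner_integral_iff)
  next
    case (insert x F)
    let ?w = "W x" and ?v = "\<lambda>\<omega>. (W x \<omega>)\<^sup>2 - s x"
    let ?b = "\<lambda>c. q x c + q c x"
    let ?Z = "\<lambda>\<omega>. \<Sum>c\<in>F. ?b c * W c \<omega>"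
    let ?B = "(\<Sum>c\<in>F. (q c c)\<^sup>2 * expectation (\<lambda>\<omega>. W c \<omega> ^ 4))
      + 2 * (\<Sum>c\<in>F. \<Sum>d\<in>F. (q c d)\<^sup>2 * (s c * s d))"
    have indF: "indep_vars (\<lambda>_. borel) W F" using insert.prems(1) by (rule indep_vars_subset) auto
    have IH: "has_bochner_integral M (H F) 0" "integrable M (\<lambda>\<omega>. (H F \<omega>)\<^sup>2)"
      "expectation (\<lambda>\<omega>. (H F \<omega>)\<^sup>2) \<le> ?B"
      using insert.IH[OF indF] insert.prems by auto
    have Z: "has_bochner_integral M ?Z 0"
        "has_bochner_integral M (\<lambda>\<omega>. (?Z \<omega>)\<^sup>2) (\<Sum>c\<in>F. (?b c)\<^sup>2 * s c)"
      using linear_form_moments[OF insert.hyps(1) indF, where s = s and b = ?b] insert.prems by auto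
    have s_nonneg: "s c \<ge> 0" if "c \<in> insert x F" for c
    proof -
      have "0 \<le> expectation (\<lambda>\<omega>. (W c \<omega>)\<^sup>2)"
        by (intro Bochner_Integration.integral_nonneg) simp
      then show ?thesis
        unfolding has_bochner_integral_integral_eq[OF insert.prems(3)[OF that]] .
    qed
    have wm[measurable]: "W c \<in> borel_measurable M" if "c \<in> insert x F" for c
      using insert.prems(2)[OF that]
      by (auto simp: has_bochner_integral_iff intro: borel_measurable_integrable)
    have wx[measurable]: "W x \<in> borel_measurable M" using wm by simp
    have wpow: "integrable M (\<lambda>\<omega>. W x \<omega> ^ k)" if "k \<le> 4" for k
      using integrable_power_le_four[OF wx insert.prems(4) that] by simp
    have w: "has_bochner_integral M ?w 0" "has_bochner_integral M (\<lambda>\<omega>. (?w \<omega>)\<^sup>2) (s x)"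
      using insert.prems by auto
    have v: "has_bochner_integral M ?v 0"
      using has_bochner_integral_diff[OF w(2), of "\<lambda>_. s x" "s x"]
      by (simp add: has_bochner_integral_iff prob_space)
    have v2: "(?v \<omega>)\<^sup>2 = W x \<omega> ^ 4 - 2 * s x * (W x \<omega>)\<^sup>2 + (s x)\<^sup>2" for \<omega>
      by (simp add: power4_eq_xxxx power2_eq_square algebra_simps)
    have v2i: "has_bochner_integral M (\<lambda>\<omega>. (?v \<omega>)\<^sup>2) (expectation (\<lambda>\<omega>. W x \<omega> ^ 4) - (s x)\<^sup>2)"
      unfolding v2 using wpow[of 4] w(2)
      by (simp add: has_bochner_integral_iff prob_space power2_eq_square)
    have wv: "has_bochner_integral M (\<lambda>\<omega>. ?w \<omega> * ?v \<omega>) (expectation (\<lambda>\<omega>. ?w \<omega> * ?v \<omega>))"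
      unfolding has_bochner_integral_iff
      using wpow[of 3] wpow[of 1] by (simp add: right_diff_distrib power2_eq_square power3_eq_cube mult.assoc)
    have Zm: "(\<lambda>h. \<Sum>c\<in>F. ?b c * h c) \<in> borel_measurable (PiM F (\<lambda>_. borel))" by simp
    have Hm: "(\<lambda>h. (\<Sum>c\<in>F. \<Sum>d\<in>F. q c d * (h c * h d)) - (\<Sum>c\<in>F. q c c * s c))
        \<in> borel_measurable (PiM F (\<lambda>_. borel))"
      by simp
    have ind: "indep_var borel (\<lambda>\<omega>. f (W x \<omega>)) borel (\<lambda>\<omega>. g (H F \<omega>) (?Z \<omega>) :: real)"
      if f: "f \<in> borel_measurable borel" and g: "case_prod g \<in> borel_measurable (borel \<Otimes>\<^sub>M borel)"
      for f :: "real \<Rightarrow> real" and g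
    proof -
      let ?g = "\<lambda>h. g ((\<Sum>c\<in>F. \<Sum>d\<in>F. q c d * (h c * h d)) - (\<Sum>c\<in>F. q c c * s c))
        (\<Sum>c\<in>F. ?b c * h c)"
      have "?g \<in> borel_measurable (PiM F (\<lambda>_. borel))"
        using measurable_compose[OF measurable_Pair[OF Hm Zm] g] by simp
      from indep_var_insert[OF insert.prems(1) insert.hyps(2) f this]
      show ?thesis by (simp add: H_def)
    qed
    have HZ: "has_bochner_integral M (\<lambda>\<omega>. H F \<omega> * ?Z \<omega>) (expectation (\<lambda>\<omega>. H F \<omega> * ?Z \<omega>))"
      unfolding has_bochner_integral_iff
      using integrable_mult_of_square_integrable[of "H F" ?Z] IH Z
      by (simp add: has_bochner_integral_iff borel_measurable_integrable)
    have H2: "has_bochner_integral M (\<lambda>\<omega>. (H F \<omega>)\<^sup>2) (expectation (\<lambda>\<omega>. (H F \<omega>)\<^sup>2))"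
      using IH by (simp add: has_bochner_integral_iff)
    have t1: "has_bochner_integral M (\<lambda>\<omega>. ?w \<omega> * ?Z \<omega>) (0 * 0)"
      by (rule has_bochner_integral_indep_mult[OF ind[of "\<lambda>w. w" "\<lambda>h z. z"] w(1) Z(1)]) simp_all
    have t2: "has_bochner_integral M (\<lambda>\<omega>. (?w \<omega>)\<^sup>2 * (?Z \<omega>)\<^sup>2) (s x * (\<Sum>c\<in>F. (?b c)\<^sup>2 * s c))"
      by (rule has_bochner_integral_indep_mult[OF ind[of "\<lambda>w. w\<^sup>2" "\<lambda>h z. z\<^sup>2"] w(2) Z(2)]) simp_all
    have t3: "has_bochner_integral M (\<lambda>\<omega>. ?w \<omega> * (H F \<omega> * ?Z \<omega>))
        (0 * expectation (\<lambda>\<omega>. H F \<omega> * ?Z \<omega>))"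
      by (rule has_bochner_integral_indep_mult[OF ind[of "\<lambda>w. w" "\<lambda>h z. h * z"] w(1) HZ]) simp_all
    have t4: "has_bochner_integral M (\<lambda>\<omega>. ?v \<omega> * H F \<omega>) (0 * 0)"
      by (rule has_bochner_integral_indep_mult[OF ind[of "\<lambda>w. w\<^sup>2 - s x" "\<lambda>h z. h"] v IH(1)]) simp_all
    have t5: "has_bochner_integral M (\<lambda>\<omega>. (?w \<omega> * ?v \<omega>) * ?Z \<omega>)
        (expectation (\<lambda>\<omega>. ?w \<omega> * ?v \<omega>) * 0)"
      by (rule has_bochner_integral_indep_mult[OF ind[of "\<lambda>w. w * (w\<^sup>2 - s x)" "\<lambda>h z. z"] wv Z(1)])
        simp_all
    have step: "H (insert x F) \<omega> = H F \<omega> + ?w \<omega> * ?Z \<omega> + q x x * ?v \<omega>" for \<omega>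
      using insert.hyps
      by (simp add: H_def sum.distrib sum_distrib_left algebra_simps power2_eq_square)
    have "has_bochner_integral M (\<lambda>\<omega>. H F \<omega> + ?w \<omega> * ?Z \<omega> + q x x * ?v \<omega>) (0 + 0 * 0 + q x x * 0)"
      by (intro has_bochner_integral_add has_bochner_integral_mult_right IH t1 v)
    then have mean: "has_bochner_integral M (H (insert x F)) 0"
      by (simp add: step[abs_def])
    have sq: "(H (insert x F) \<omega>)\<^sup>2 = (H F \<omega>)\<^sup>2 + (?w \<omega>)\<^sup>2 * (?Z \<omega>)\<^sup>2 + (q x x)\<^sup>2 * (?v \<omega>)\<^sup>2
        + 2 * (?w \<omega> * (H F \<omega> * ?Z \<omega>)) + 2 * q x x * (?v \<omega> * H F \<omega>)
        + 2 * q x x * ((?w \<omega> * ?v \<omega>) * ?Z \<omega>)" for \<omega>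
    proof -
      have "(h + w * z + r * v)\<^sup>2 = h\<^sup>2 + w\<^sup>2 * z\<^sup>2 + r\<^sup>2 * v\<^sup>2 + 2 * (w * (h * z)) + 2 * r * (v * h)
        + 2 * r * ((w * v) * z)" for h w z r v :: real
        by (simp add: power2_eq_square algebra_simps)
      then show ?thesis unfolding step .
    qed
    have var: "has_bochner_integral M (\<lambda>\<omega>. (H (insert x F) \<omega>)\<^sup>2)
        (expectation (\<lambda>\<omega>. (H F \<omega>)\<^sup>2) + s x * (\<Sum>c\<in>F. (?b c)\<^sup>2 * s c)
         + (q x x)\<^sup>2 * (expectation (\<lambda>\<omega>. W x \<omega> ^ 4) - (s x)\<^sup>2)
         + 2 * (0 * expectation (\<lambda>\<omega>. H F \<omega> * ?Z \<omega>)) + 2 * q x x * (0 * 0)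
         + 2 * q x x * (expectation (\<lambda>\<omega>. ?w \<omega> * ?v \<omega>) * 0))"
      unfolding sq
      by (intro has_bochner_integral_add has_bochner_integral_mult_right H2 t2 v2i t3 t4 t5)
    have "s x * (\<Sum>c\<in>F. (?b c)\<^sup>2 * s c) \<le> s x * (\<Sum>c\<in>F. (2 * (q x c)\<^sup>2 + 2 * (q c x)\<^sup>2) * s c)"
    proof (intro mult_left_mono sum_mono mult_right_mono)
      show "(?b c)\<^sup>2 \<le> 2 * (q x c)\<^sup>2 + 2 * (q c x)\<^sup>2" for c
        using sum_squares_bound[of "q x c" "q c x"] by (simp add: power2_sum)
    qed (use s_nonneg in auto)
    also have "\<dots> = 2 * (\<Sum>c\<in>F. (q x c)\<^sup>2 * (s x * s c)) + 2 * (\<Sum>c\<in>F. (q c x)\<^sup>2 * (s c * s x))"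
      by (simp add: sum_distrib_left sum.distrib[symmetric] algebra_simps)
    finally have cross: "s x * (\<Sum>c\<in>F. (?b c)\<^sup>2 * s c) \<le>
      2 * (\<Sum>c\<in>F. (q x c)\<^sup>2 * (s x * s c)) + 2 * (\<Sum>c\<in>F. (q c x)\<^sup>2 * (s c * s x))" .
    have diag: "(q x x)\<^sup>2 * (expectation (\<lambda>\<omega>. W x \<omega> ^ 4) - (s x)\<^sup>2)
        \<le> (q x x)\<^sup>2 * expectation (\<lambda>\<omega>. W x \<omega> ^ 4)"
      by (intro mult_left_mono) auto
    have xx: "0 \<le> (q x x)\<^sup>2 * (s x * s x)" by simp
    have "expectation (\<lambda>\<omega>. (H (insert x F) \<omega>)\<^sup>2) =
        expectation (\<lambda>\<omega>. (H F \<omega>)\<^sup>2) + s x * (\<Sum>c\<in>F. (?b c)\<^sup>2 * s c)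
         + (q x x)\<^sup>2 * (expectation (\<lambda>\<omega>. W x \<omega> ^ 4) - (s x)\<^sup>2)"
      using has_bochner_integral_integral_eq[OF var] by simp
    also have "\<dots> \<le> ?B + (2 * (\<Sum>c\<in>F. (q x c)\<^sup>2 * (s x * s c)) + 2 * (\<Sum>c\<in>F. (q c x)\<^sup>2 * (s c * s x)))
      + (q x x)\<^sup>2 * expectation (\<lambda>\<omega>. W x \<omega> ^ 4) + 2 * ((q x x)\<^sup>2 * (s x * s x))"
      using cross diag xx IH(3) by linarith
    also have "\<dots> = (\<Sum>c\<in>insert x F. (q c c)\<^sup>2 * expectation (\<lambda>\<omega>. W c \<omega> ^ 4))
      + 2 * (\<Sum>c\<in>insert x F. \<Sum>d\<in>insert x F. (q c d)\<^sup>2 * (s c * s d))"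
      using insert.hyps by (simp add: sum.distrib)
    finally show ?case
      using mean var by (simp add: has_bochner_integral_iff)
  qed
  then show "has_bochner_integral M (H F) 0" "integrable M (\<lambda>\<omega>. (H F \<omega>)\<^sup>2)"
    "expectation (\<lambda>\<omega>. (H F \<omega>)\<^sup>2) \<le> (\<Sum>c\<in>F. (q c c)\<^sup>2 * expectation (\<lambda>\<omega>. W c \<omega> ^ 4))
      + 2 * (\<Sum>c\<in>F. \<Sum>d\<in>F. (q c d)\<^sup>2 * (s c * s d))"
    by blast+
qed

end

lemma (in prob_space)
  assumes "X \<in> borel_measurable M" "prob_space N" "Y \<in> borel_measurable N"
    and law: "distr M borel X = distr N borel (Y :: _ \<Rightarrow> real)"
  shows same_law_integrable:
      "f \<in> borel_measurable borel \<Longrightarrow> integrable M (\<lambda>\<omega>. f (X \<omega>) :: real) \<longleftrightarrow> integrable N (\<lambda>\<omega>. f (Y \<omega>))"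
    and same_law_expectation:
      "f \<in> borel_measurable borel \<Longrightarrow> expectation (\<lambda>\<omega>. f (X \<omega>) :: real) = (\<integral>\<omega>. f (Y \<omega>) \<partial>N)"
    and same_law_mean: "expectation X = (\<integral>\<omega>. Y \<omega> \<partial>N)"
    and same_law_variance: "variance X = prob_space.variance N Y"
    and same_law_fourth_cumulant: "fourth_cumulant X = prob_space.fourth_cumulant N Y"
proof -
  interpret N: prob_space N by fact
  show "integrable M (\<lambda>\<omega>. f (X \<omega>) :: real) \<longleftrightarrow> integrable N (\<lambda>\<omega>. f (Y \<omega>))"
    if "f \<in> borel_measurable borel" for f
    using assms that by (metis integrable_distr_eq)
  show E: "expectation (\<lambda>\<omega>. f (X \<omega>) :: real) = (\<integral>\<omega>. f (Y \<omega>) \<partial>N)"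
    if "f \<in> borel_measurable borel" for f
    using assms that by (metis integral_distr)
  show mean: "expectation X = (\<integral>\<omega>. Y \<omega> \<partial>N)" using E[of "\<lambda>x. x"] by simp
  show var: "variance X = N.variance Y"
    unfolding mean by (rule E) simp
  show "fourth_cumulant X = N.fourth_cumulant Y"
    unfolding fourth_cumulant_def N.fourth_cumulant_def var unfolding mean
    by (subst E) auto
qed

text \<open>Chebyshev's inequality, with the radius chosen so that \<open>C / b\<^sup>2 < \<epsilon>\<close>.\<close>
lemma (in prob_space) tight_of_bounded_second_moment:
  assumes Z: "\<And>n. Z n \<in> borel_measurable M" and int: "\<And>n. integrable M (\<lambda>\<omega>. (Z n \<omega>)\<^sup>2)"
    and C: "\<And>n. expectation (\<lambda>\<omega>. (Z n \<omega>)\<^sup>2) \<le> C"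
  shows "tight (\<lambda>n. distr M borel (Z n))"
  unfolding tight_def
proof (intro conjI allI impI)
  show "real_distribution (distr M borel (Z n))" for n
    using Z by (rule real_distribution_distr)
  fix \<epsilon> :: real assume \<epsilon>: "\<epsilon> > 0"
  have C0: "C \<ge> 0"
    by (intro order_trans[OF _ C[of 0]] Bochner_Integration.integral_nonneg) simp
  define b where "b = sqrt (C / \<epsilon> + 1)"
  have b: "b > 0" "b\<^sup>2 = C / \<epsilon> + 1" using C0 \<epsilon> by (auto simp: b_def intro: add_nonneg_pos)
  have Cb: "C / b\<^sup>2 < \<epsilon>"
    using C0 \<epsilon> by (simp add: b(2) divide_less_eq field_simps)
  show "\<exists>a b. a < b \<and> (\<forall>n. 1 - \<epsilon> < measure (distr M borel (Z n)) {a<..b})"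
  proof (rule exI[of _ "- b"], rule exI[of _ b], intro conjI allI)
    fix n
    let ?E = "{\<omega>\<in>space M. \<bar>Z n \<omega>\<bar> \<ge> b}"
    have m[measurable]: "Z n \<in> borel_measurable M" by (rule Z)
    have "prob ?E \<le> expectation (\<lambda>\<omega>. (Z n \<omega>)\<^sup>2) / b\<^sup>2"
      by (rule second_moment_method[OF Z int b(1)])
    also have "\<dots> \<le> C / b\<^sup>2" using C by (intro divide_right_mono) auto
    finally have "prob ?E < \<epsilon>" using Cb by simp
    then have "1 - \<epsilon> < prob (space M - ?E)" by (subst prob_compl) auto
    also have "\<dots> \<le> prob (Z n -` {- b<..b} \<inter> space M)"
      by (intro finite_measure_mono) (auto simp: not_le)
    also have "\<dots> = measure (distr M borel (Z n)) {- b<..b}"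
      by (subst measure_distr) auto
    finally show "1 - \<epsilon> < measure (distr M borel (Z n)) {- b<..b}" .
  qed (use b in simp)
qed

section \<open>Moments of a Levy basis\<close>

lemma finite_area_subset:
  "finite_area B \<Longrightarrow> C \<in> sets borel \<Longrightarrow> C \<subseteq> B \<Longrightarrow> finite_area C"
  unfolding finite_area_def using le_less_trans[OF emeasure_mono[of C B lborel]] by auto

lemma finite_area_UN:
  assumes "finite I" "\<And>i. i \<in> I \<Longrightarrow> finite_area (B i)"
  shows "finite_area (\<Union>i\<in>I. B i)"
proof -
  have "emeasure lborel (\<Union>i\<in>I. B i) \<le> (\<Sum>i\<in>I. emeasure lborel (B i))"
    using assms by (intro emeasure_subadditive_finite) (auto simp: finite_area_def)
  also have "\<dots> < \<infinity>" using assms by (auto simp: finite_area_def)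
  finally show ?thesis using assms by (auto simp: finite_area_def intro!: sets.finite_UN)
qed

context homogeneous_levy_basis
begin

text \<open>Independence and additivity of a Levy basis concern sequences of sets; a finite family is turned
into a sequence by enumerating it and continuing with empty sets.\<close>
lemma extend_by_empty:
  assumes "finite I" "\<And>i. i \<in> I \<Longrightarrow> finite_area (B i)" "disjoint_family_on B I"
  obtains h :: "'i \<Rightarrow> nat" and B' :: "nat \<Rightarrow> (real \<times> real) set"
  where "bij_betw h I {..<card I}" "\<And>i. i \<in> I \<Longrightarrow> B' (h i) = B i"
    "\<And>j. j \<ge> card I \<Longrightarrow> B' j = {}" "\<And>j. finite_area (B' j)" "disjoint_family B'"
proof -
  obtain h where h: "bij_betw h I {..<card I}"
    using ex_bij_betw_finite_nat[OF assms(1)] by (auto simp: lessThan_atLeast0)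
  define B' where "B' j = (if j < card I then B (inv_into I h j) else {})" for j
  have inv: "inv_into I h j \<in> I" "h (inv_into I h j) = j" if "j < card I" for j
    using h that by (metis bij_betw_imp_surj_on inv_into_into lessThan_iff)
      (metis h that bij_betw_inv_into_right lessThan_iff)
  have 1: "B' (h i) = B i" if "i \<in> I" for i
    using h that by (metis B'_def bij_betw_apply bij_betw_inv_into_left lessThan_iff)
  have 2: "finite_area (B' j)" for j
    using assms(2) inv by (auto simp: B'_def finite_area_def)
  have "B' i \<inter> B' j = {}" if "i \<noteq> j" for i j
  proof (cases "i < card I \<and> j < card I")
    case True
    then have "inv_into I h i \<noteq> inv_into I h j" using inv that by metis
    then show ?thesis
      using True inv assms(3) by (simp add: B'_def disjoint_family_on_def)
  qed (auto simp: B'_def)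
  then have 3: "disjoint_family B'" by (simp add: disjoint_family_on_def)
  show ?thesis by (rule that[OF h 1 _ 2 3]) (auto simp: B'_def)
qed

lemma indep_disjoint:
  assumes "finite I" "\<And>i. i \<in> I \<Longrightarrow> finite_area (B i)" "disjoint_family_on B I"
  shows "indep_vars (\<lambda>_. borel) (\<lambda>i. L (B i)) I"
proof -
  obtain h :: "'b \<Rightarrow> nat" and B' where h: "bij_betw h I {..<card I}" and B': "\<And>i. i \<in> I \<Longrightarrow> B' (h i) = B i"
    and fa: "\<And>j. finite_area (B' j)" and dis: "disjoint_family B'"
    using extend_by_empty[OF assms] by metis
  have "indep_vars (\<lambda>_. borel) (\<lambda>i. L (B' (h i))) I"
    using indep_vars_reindex_inj[OF independently_scattered[OF fa dis], of h I] h
    by (auto simp: bij_betw_def)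
  then show ?thesis
    by (subst (asm) indep_vars_cong[where J = I and Y = "\<lambda>i. L (B i)"]) (auto simp: B')
qed

text \<open>A convergent series with constant terms has zero terms.\<close>
lemma basis_empty: "AE \<omega> in M. L {} \<omega> = 0"
proof -
  have "AE \<omega> in M. (\<lambda>i::nat. L {} \<omega>) sums L (\<Union>i::nat. {}) \<omega>"
    by (rule sigma_additive) (auto simp: finite_area_def disjoint_family_on_def)
  then show ?thesis by eventually_elim (metis sums_summable summable_const_iff)
qed

lemma finitely_additive:
  assumes "finite I" "\<And>i. i \<in> I \<Longrightarrow> finite_area (B i)" "disjoint_family_on B I"
  shows "AE \<omega> in M. L (\<Union>i\<in>I. B i) \<omega> = (\<Sum>i\<in>I. L (B i) \<omega>)"
proof -
  obtain h :: "'b \<Rightarrow> nat" and B' where h: "bij_betw h I {..<card I}" and B': "\<And>i. i \<in> I \<Longrightarrow> B' (h i) = B i"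
    and em: "\<And>j. j \<ge> card I \<Longrightarrow> B' j = {}"
    and fa: "\<And>j. finite_area (B' j)" and dis: "disjoint_family B'"
    using extend_by_empty[OF assms] by metis
  have "(\<Union>j. B' j) = (\<Union>j\<in>{..<card I}. B' j)"
    using em by (auto simp: not_less[symmetric])
  also have "\<dots> = (\<Union>i\<in>I. B i)"
    using h B' by (metis (no_types, lifting) SUP_cong bij_betw_imp_surj_on image_image)
  finally have U: "(\<Union>j. B' j) = (\<Union>i\<in>I. B i)" .
  have "AE \<omega> in M. (\<lambda>j. L (B' j) \<omega>) sums L (\<Union>j. B' j) \<omega>"
    using finite_area_UN[OF assms(1,2)] by (intro sigma_additive fa dis) (simp add: U)
  with basis_empty show ?thesis
  proof eventually_elim
    case (elim \<omega>)
    have "(\<lambda>j. L (B' j) \<omega>) sums (\<Sum>j<card I. L (B' j) \<omega>)"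
      using em elim by (intro sums_finite) auto
    moreover have "(\<Sum>j<card I. L (B' j) \<omega>) = (\<Sum>i\<in>I. L (B i) \<omega>)"
      using h by (subst sum.reindex_bij_betw[OF h, symmetric]) (simp add: B')
    ultimately show ?case using elim U by (metis sums_unique2)
  qed
qed

lemma
  assumes B: "finite_area B" and C: "finite_area C" and "B \<inter> C = {}"
  shows indep_disjoint_pair: "indep_var borel (L B) borel (L C)"
    and additive_pair: "AE \<omega> in M. L (B \<union> C) \<omega> = L B \<omega> + L C \<omega>"
proof -
  have D: "disjoint_family_on (case_bool B C) UNIV" "\<And>b. finite_area (case_bool B C b)"
    using assms by (auto simp: disjoint_family_on_def split: bool.splits)
  have "indep_vars (\<lambda>_. borel) (\<lambda>b. L (case_bool B C b)) UNIV"
    by (rule indep_disjoint) (use D in auto)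
  moreover have "(\<lambda>b. L (case_bool B C b)) = case_bool (L B) (L C)"
      "(\<lambda>_::bool. borel :: real measure) = case_bool borel borel"
    by (auto simp: fun_eq_iff split: bool.splits)
  ultimately show "indep_var borel (L B) borel (L C)" by (simp add: indep_var_def)
  show "AE \<omega> in M. L (B \<union> C) \<omega> = L B \<omega> + L C \<omega>"
    using finitely_additive[of UNIV "case_bool B C"] D by (simp add: UNIV_bool Un_commute add.commute)
qed

text \<open>The characteristic function of \<open>L B\<close> sees \<open>B\<close> only through its area.\<close>
lemma law_depends_on_area:
  assumes B: "finite_area B" and C: "finite_area C" and "measure lborel B = measure lborel C"
  shows "distr M borel (L B) = distr M borel (L C)"
proof (rule Levy_uniqueness)
  show "real_distribution (distr M borel (L B))" "real_distribution (distr M borel (L C))"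
    using measurable_basis B C by (auto intro: real_distribution_distr)
  show "char (distr M borel (L B)) = char (distr M borel (L C))"
    using assms by (auto simp: char_basis)
qed

end

text \<open>Strips of unit height provide a set of every prescribed area, and adjacent strips are disjoint.
They turn statements about the dependence of \<open>L B\<close> on the area of \<open>B\<close> into statements about
functions on the half-line.\<close>
definition strip :: "real \<Rightarrow> real \<Rightarrow> (real \<times> real) set" where
  "strip u v = {u<..v} \<times> {0..1}"

lemma strip_area:
  assumes "u \<le> v"
  shows "finite_area (strip u v)" "measure lborel (strip u v) = v - u"
proof -
  have "emeasure lborel (strip u v) = emeasure lborel {u<..v} * emeasure lborel {0..1::real}"
    unfolding strip_def lborel_prod[symmetric] by (subst lborel.emeasure_pair_measure_Times) auto
  then have e: "emeasure lborel (strip u v) = ennreal (v - u)" using assms by simp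
  moreover have "strip u v \<in> sets borel"
    unfolding strip_def borel_prod[symmetric] by (intro pair_measureI) auto
  ultimately show "finite_area (strip u v)" by (simp add: finite_area_def)
  show "measure lborel (strip u v) = v - u" using e assms by (simp add: measure_def)
qed

lemma strip_split:
  assumes "u \<le> v" "v \<le> w"
  shows "strip u w = strip u v \<union> strip v w" "strip u v \<inter> strip v w = {}"
  using assms by (auto simp: strip_def)

text \<open>The moment assumption is put on one set of unit area, whose law is that of the Levy seed.\<close>
locale fourth_moment_levy_basis = homogeneous_levy_basis +
  assumes unit_integrable: "integrable M (\<lambda>\<omega>. L (strip 0 1) \<omega> ^ 4)"
    and unit_variance: "variance (L (strip 0 1)) = 1"
begin

lemma strip_measurable: "u \<le> v \<Longrightarrow> L (strip u v) \<in> borel_measurable M"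
  by (intro measurable_basis strip_area)

lemma strip_law: "0 \<le> x \<Longrightarrow> 0 \<le> y \<Longrightarrow> distr M borel (L (strip x (x + y))) = distr M borel (L (strip 0 y))"
  by (intro law_depends_on_area strip_area) (auto simp: strip_area)

lemma strip_indep: "0 \<le> x \<Longrightarrow> 0 \<le> y \<Longrightarrow> indep_var borel (L (strip 0 x)) borel (L (strip x (x + y)))"
  by (intro indep_disjoint_pair strip_area strip_split) auto

lemma strip_add: "0 \<le> x \<Longrightarrow> 0 \<le> y \<Longrightarrow>
    AE \<omega> in M. L (strip 0 (x + y)) \<omega> = L (strip 0 x) \<omega> + L (strip x (x + y)) \<omega>"
  using additive_pair[of "strip 0 x" "strip x (x + y)"] strip_split[of 0 x "x + y"]
  by (simp add: strip_area)

text \<open>Finite fourth moments pass from the unit strip to strips of integer length by adding independent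
pieces, and from there to shorter strips because a summand of an independent sum inherits them.\<close>
lemma strip_integrable: "x \<ge> 0 \<Longrightarrow> integrable M (\<lambda>\<omega>. L (strip 0 x) \<omega> ^ 4)"
proof -
  assume x: "x \<ge> 0"
  have meas: "L (strip 0 x) \<in> borel_measurable M" if "x \<ge> 0" for x using that strip_measurable by simp
  have nat: "integrable M (\<lambda>\<omega>. L (strip 0 (real n)) \<omega> ^ 4)" for n
  proof (induction n)
    case 0
    have "AE \<omega> in M. L (strip 0 (real 0)) \<omega> ^ 4 = 0"
      using basis_empty by (simp add: strip_def)
    then show ?case
      using meas[of 0] by (subst integrable_cong_AE[where g = "\<lambda>_. 0"]) auto
  next
    case (Suc n)
    have "integrable M (\<lambda>\<omega>. L (strip (real n) (real n + 1)) \<omega> ^ 4)"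
      using same_law_integrable[OF _ prob_space_axioms _ strip_law[of "real n" 1], of "\<lambda>x. x ^ 4"]
        unit_integrable strip_measurable by simp
    from integrable_power_four_add[OF strip_indep Suc this]
    have "integrable M (\<lambda>\<omega>. (L (strip 0 (real n)) \<omega> + L (strip (real n) (real n + 1)) \<omega>) ^ 4)"
      by simp
    moreover have "AE \<omega> in M. L (strip 0 (real (Suc n))) \<omega> ^ 4
        = (L (strip 0 (real n)) \<omega> + L (strip (real n) (real n + 1)) \<omega>) ^ 4"
      using strip_add[of "real n" 1] by (auto simp: add.commute)
    ultimately show ?case
      using meas strip_measurable by (subst integrable_cong_AE) (auto simp: add.commute)
  qed
  obtain n :: nat where n: "x \<le> real n" using real_arch_simple by blast
  define y where "y = real n - x"
  have y: "y \<ge> 0" "real n = y + x" using n by (simp_all add: y_def)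
  have "AE \<omega> in M. L (strip 0 (real n)) \<omega> ^ 4 = (L (strip 0 y) \<omega> + L (strip y (y + x)) \<omega>) ^ 4"
    using strip_add[of y x] x y by auto
  then have "integrable M (\<lambda>\<omega>. (L (strip 0 y) \<omega> + L (strip y (y + x)) \<omega>) ^ 4)"
    using nat[of n] meas strip_measurable x y
    by (subst (asm) integrable_cong_AE) auto
  from integrable_power_four_summand[OF strip_indep this]
  have "integrable M (\<lambda>\<omega>. L (strip y (y + x)) \<omega> ^ 4)" using x y by simp
  then show ?thesis
    using same_law_integrable[OF _ prob_space_axioms _ strip_law[of y x], of "\<lambda>x. x ^ 4"] x y
      strip_measurable by simp
qed

text \<open>The fourth cumulant of the basis per unit area.\<close>
definition \<kappa> :: real where "\<kappa> = fourth_cumulant (L (strip 0 1))"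

lemma strip_cumulants_add:
  assumes x: "0 \<le> x" and y: "0 \<le> y"
  shows "variance (L (strip 0 (x + y))) = variance (L (strip 0 x)) + variance (L (strip 0 y))"
    and "fourth_cumulant (L (strip 0 (x + y))) =
      fourth_cumulant (L (strip 0 x)) + fourth_cumulant (L (strip 0 y))"
proof -
  let ?S = "\<lambda>\<omega>. L (strip 0 x) \<omega> + L (strip x (x + y)) \<omega>"
  have m: "L (strip 0 (x + y)) \<in> borel_measurable M" "L (strip 0 x) \<in> borel_measurable M"
    "L (strip x (x + y)) \<in> borel_measurable M" "L (strip 0 y) \<in> borel_measurable M"
    using x y strip_measurable by auto
  have i: "integrable M (\<lambda>\<omega>. L (strip x (x + y)) \<omega> ^ 4)"
    using same_law_integrable[OF _ prob_space_axioms _ strip_law[of x y], of "\<lambda>x. x ^ 4"] x y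
      strip_integrable[of y] m by simp
  have law: "distr M borel (L (strip 0 (x + y))) = distr M borel ?S"
    using strip_add[OF x y] m by (intro distr_cong_AE) auto
  note S = same_law_variance[OF _ prob_space_axioms _ law]
    same_law_fourth_cumulant[OF _ prob_space_axioms _ law]
  note T = same_law_variance[OF _ prob_space_axioms _ strip_law[OF x y]]
    same_law_fourth_cumulant[OF _ prob_space_axioms _ strip_law[OF x y]]
  note A = variance_add[OF strip_indep[OF x y] strip_integrable[OF x] i]
    fourth_cumulant_add[OF strip_indep[OF x y] strip_integrable[OF x] i]
  show "variance (L (strip 0 (x + y))) = variance (L (strip 0 x)) + variance (L (strip 0 y))"
    using S(1) T(1) A(1) m by simp
  show "fourth_cumulant (L (strip 0 (x + y))) =
      fourth_cumulant (L (strip 0 x)) + fourth_cumulant (L (strip 0 y))"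
    using S(2) T(2) A(2) m by simp
qed

text \<open>Variance and fourth cumulant of \<open>L\<close> on the strip of length \<open>x\<close> are additive in \<open>x\<close>, hence
linear: the variance is nonnegative, and the fourth cumulant is at least minus three times the square
of the variance.\<close>
lemma strip_variance: "x \<ge> 0 \<Longrightarrow> variance (L (strip 0 x)) = x"
  using linear_of_additive_bounded_below[of "\<lambda>x. variance (L (strip 0 x))" 0 x]
    strip_cumulants_add(1) unit_variance by simp

lemma strip_fourth_cumulant: "x \<ge> 0 \<Longrightarrow> fourth_cumulant (L (strip 0 x)) = \<kappa> * x"
  unfolding \<kappa>_def
proof (rule linear_of_additive_bounded_below[where C = 3])
  fix x :: real assume x: "0 \<le> x" "x \<le> 1"
  have "(variance (L (strip 0 x)))\<^sup>2 \<le> 1"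
    using strip_variance x by (simp add: power_le_one)
  moreover have "0 \<le> expectation (\<lambda>\<omega>. (L (strip 0 x) \<omega> - expectation (L (strip 0 x))) ^ 4)"
    by (intro Bochner_Integration.integral_nonneg) simp
  ultimately show "- 3 \<le> fourth_cumulant (L (strip 0 x))"
    unfolding fourth_cumulant_def by linarith
qed (auto intro: strip_cumulants_add)

text \<open>A set has the law of the strip of the same area. The fourth central moment is of the order of the
area itself and not of its square; it is this term that the diagonal of a quadratic form in the
values of \<open>L\<close> sees.\<close>
lemma
  assumes B: "finite_area B"
  shows basis_integrable: "integrable M (\<lambda>\<omega>. L B \<omega> ^ 4)"
    and basis_variance: "variance (L B) = measure lborel B"
    and basis_fourth_moment: "expectation (\<lambda>\<omega>. (L B \<omega> - expectation (L B)) ^ 4)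
      = \<kappa> * measure lborel B + 3 * (measure lborel B)\<^sup>2"
proof -
  let ?x = "measure lborel B"
  have law: "distr M borel (L B) = distr M borel (L (strip 0 ?x))"
    by (intro law_depends_on_area B strip_area) (auto simp: strip_area)
  have m: "L B \<in> borel_measurable M" "L (strip 0 ?x) \<in> borel_measurable M"
    using measurable_basis B strip_measurable by auto
  note S = same_law_integrable[OF m(1) prob_space_axioms m(2) law, of "\<lambda>x. x ^ 4"]
    same_law_variance[OF m(1) prob_space_axioms m(2) law]
    same_law_fourth_cumulant[OF m(1) prob_space_axioms m(2) law]
  show "integrable M (\<lambda>\<omega>. L B \<omega> ^ 4)" using S(1) strip_integrable by simp
  show v: "variance (L B) = ?x" using S(2) strip_variance by simp
  have "fourth_cumulant (L B) = \<kappa> * ?x" using S(3) strip_fourth_cumulant by simp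
  then show "expectation (\<lambda>\<omega>. (L B \<omega> - expectation (L B)) ^ 4) = \<kappa> * ?x + 3 * ?x\<^sup>2"
    unfolding fourth_cumulant_def v by simp
qed

end

section \<open>Products of increments of a Levy basis along a sequence of sets\<close>

text \<open>If \<open>S\<close> is the set of indices \<open>k\<close> for which a point belongs to \<open>A k\<close>, then the sign is the
difference of the indicators of \<open>A (Suc k)\<close> and \<open>A k\<close> at that point: it is 1 when the point enters and
-1 when it leaves.\<close>
definition incr_sign :: "nat \<Rightarrow> nat set \<Rightarrow> real" where
  "incr_sign k S = of_bool (Suc k \<in> S) - of_bool (k \<in> S)"

definition order_convex :: "nat set \<Rightarrow> bool" where
  "order_convex S \<longleftrightarrow> (\<forall>i j k. i \<in> S \<longrightarrow> k \<in> S \<longrightarrow> i \<le> j \<longrightarrow> j \<le> k \<longrightarrow> j \<in> S)"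

text \<open>A point that belongs to the sets for an interval of indices enters once and leaves once.\<close>
lemma incr_sign_product_nonpos:
  assumes S: "order_convex S" and "j < k"
  shows "incr_sign k S * incr_sign j S \<le> 0"
proof (rule ccontr)
  assume "\<not> ?thesis"
  then consider "Suc k \<in> S" "k \<notin> S" "Suc j \<in> S" "j \<notin> S" | "Suc k \<notin> S" "k \<in> S" "Suc j \<notin> S" "j \<in> S"
    by (auto simp: incr_sign_def of_bool_def split: if_splits)
  then show False
  proof cases
    case 1
    then show False using S \<open>j < k\<close> unfolding order_convex_def
      by (meson Suc_leI le_SucI order_refl)
  next
    case 2
    then show False using S \<open>j < k\<close> unfolding order_convex_def
      by (meson Suc_leI le_SucI order_refl)
  qed
qed

lemma sum_incr_sign_le:
  assumes S: "order_convex S" and "finite K"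
  shows "(\<Sum>k\<in>K. \<bar>incr_sign k S\<bar>) \<le> 2"
proof -
  let ?P = "{k\<in>K. incr_sign k S = 1}" and ?N = "{k\<in>K. incr_sign k S = - 1}"
  have uniq: "j = k" if "incr_sign j S = incr_sign k S" "incr_sign k S \<noteq> 0" for j k
  proof (rule ccontr)
    assume "j \<noteq> k"
    then have "incr_sign k S * incr_sign j S \<le> 0"
      using incr_sign_product_nonpos[OF S] by (metis linorder_neqE_nat mult.commute)
    then have "(incr_sign k S)\<^sup>2 \<le> 0" using that(1) by (simp add: power2_eq_square)
    then show False using that(2) by simp
  qed
  have card: "card ?P \<le> 1" "card ?N \<le> 1"
    using uniq assms(2) by (auto simp: card_le_Suc0_iff_eq)
  have "(\<Sum>k\<in>K. \<bar>incr_sign k S\<bar>) = (\<Sum>k\<in>K. of_bool (incr_sign k S = 1) + of_bool (incr_sign k S = - 1))"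
    by (intro sum.cong) (auto simp: incr_sign_def)
  also have "\<dots> = real (card ?P) + real (card ?N)"
    using assms(2) by (simp add: sum.distrib of_bool_def sum.If_cases Int_def)
  finally show ?thesis using card by simp
qed

text \<open>The sets \<open>A 0, ..., A n\<close> cut the plane into cells of points with a common signature. Only nonempty
cells are indexed, so that every indexed signature inherits order convexity from a point; the empty
signature is excluded because its cell has infinite area.\<close>
context
  fixes A :: "nat \<Rightarrow> (real \<times> real) set" and n :: nat
begin

definition signature :: "real \<times> real \<Rightarrow> nat set" where
  "signature p = {k \<in> {..n}. p \<in> A k}"

definition cell :: "nat set \<Rightarrow> (real \<times> real) set" where
  "cell S = signature -` {S}"

definition signatures :: "nat set set" where
  "signatures = {S \<in> Pow {..n}. S \<noteq> {} \<and> cell S \<noteq> {}}"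

lemma finite_signatures: "finite signatures"
  by (simp add: signatures_def)

lemma disjoint_cells: "disjoint_family_on cell I"
  by (auto simp: disjoint_family_on_def cell_def)

lemma mem_cell [simp]: "p \<in> cell S \<longleftrightarrow> signature p = S"
  by (simp add: cell_def)

lemma mem_signature: "k \<le> n \<Longrightarrow> k \<in> signature p \<longleftrightarrow> p \<in> A k"
  by (simp add: signature_def)

lemma signature_in_signatures:
  assumes "k \<in> signature p"
  shows "signature p \<in> signatures"
proof -
  have "p \<in> cell (signature p)" by simp
  then have "cell (signature p) \<noteq> {}" by blast
  moreover have "signature p \<subseteq> {..n}" by (auto simp: signature_def)
  ultimately show ?thesis using assms by (auto simp: signatures_def)
qed

lemma signaturesE:
  assumes "S \<in> signatures"
  obtains k p where "k \<in> S" "k \<le> n" "S = {j \<in> {..n}. p \<in> A j}"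
proof -
  have "cell S \<noteq> {}" using assms by (simp add: signatures_def)
  then obtain p where p: "p \<in> cell S" by blast
  obtain k where "k \<in> S" "k \<le> n" using assms by (auto simp: signatures_def)
  moreover have "S = {j \<in> {..n}. p \<in> A j}" using p by (simp add: signature_def)
  ultimately show ?thesis by (rule that)
qed

lemma union_cells:
  assumes "k \<le> n"
  shows "A k = (\<Union>S\<in>{S\<in>signatures. k \<in> S}. cell S)"
proof (rule set_eqI)
  fix p
  show "p \<in> A k \<longleftrightarrow> p \<in> (\<Union>S\<in>{S\<in>signatures. k \<in> S}. cell S)"
    using mem_signature[OF assms, of p] signature_in_signatures[of k p] by auto
qed

lemma finite_area_cell:
  assumes A: "\<And>k. k \<le> n \<Longrightarrow> finite_area (A k)" and S: "S \<in> signatures"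
  shows "finite_area (cell S)"
proof -
  obtain k where k: "k \<in> S" "k \<le> n" using S by (rule signaturesE)
  have "S \<subseteq> {..n}" using S by (simp add: signatures_def)
  then have "cell S = (\<Inter>j\<in>{..n}. if j \<in> S then A j else - A j)"
  proof (intro set_eqI)
    fix p
    have "signature p = S \<longleftrightarrow> (\<forall>j\<le>n. p \<in> A j \<longleftrightarrow> j \<in> S)"
      using \<open>S \<subseteq> {..n}\<close> unfolding signature_def by blast
    also have "\<dots> \<longleftrightarrow> (\<forall>j\<le>n. p \<in> (if j \<in> S then A j else - A j))" by auto
    finally show "p \<in> cell S \<longleftrightarrow> p \<in> (\<Inter>j\<in>{..n}. if j \<in> S then A j else - A j)"
      by (simp only: mem_cell INT_iff atMost_iff Ball_def)
  qed
  moreover have "\<dots> \<in> sets borel"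
    using A by (intro sets.finite_INT) (auto simp: finite_area_def intro!: borel_comp)
  ultimately have "cell S \<in> sets borel" by simp
  moreover have "cell S \<subseteq> A k" using union_cells[OF k(2)] S k(1) by auto
  ultimately show ?thesis using A[OF k(2)] finite_area_subset by blast
qed

lemma measure_Int_cells:
  assumes A: "\<And>k. k \<le> n \<Longrightarrow> finite_area (A k)" and "i \<le> n" "j \<le> n"
  shows "measure lborel (A i \<inter> A j)
    = (\<Sum>S\<in>signatures. of_bool (i \<in> S) * of_bool (j \<in> S) * measure lborel (cell S))"
proof -
  have "A i \<inter> A j = (\<Union>S\<in>{S\<in>signatures. i \<in> S \<and> j \<in> S}. cell S)"
  proof (rule set_eqI)
    fix p
    show "p \<in> A i \<inter> A j \<longleftrightarrow> p \<in> (\<Union>S\<in>{S\<in>signatures. i \<in> S \<and> j \<in> S}. cell S)"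
      using mem_signature[OF assms(2), of p] mem_signature[OF assms(3), of p]
        signature_in_signatures[of i p] by auto
  qed
  moreover have "measure lborel \<dots> = (\<Sum>S\<in>{S\<in>signatures. i \<in> S \<and> j \<in> S}. measure lborel (cell S))"
    using finite_area_cell[OF A] finite_signatures disjoint_cells
    by (intro measure_finite_Union) (auto simp: finite_area_def less_top[symmetric])
  ultimately show ?thesis
    using finite_signatures
    by (simp add: sum.inter_filter of_bool_def if_distrib[of "\<lambda>x. x * _"] cong: if_cong)
      (intro sum.cong, auto)
qed

text \<open>For a Levy basis with unit variance per area this is the covariance of the increments of
\<open>L \<circ> A\<close> with indices \<open>k\<close> and \<open>j\<close>.\<close>
definition second_difference :: "nat \<Rightarrow> nat \<Rightarrow> real" where
  "second_difference k j = measure lborel (A (Suc k) \<inter> A (Suc j)) - measure lborel (A (Suc k) \<inter> A j)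
     - measure lborel (A k \<inter> A (Suc j)) + measure lborel (A k \<inter> A j)"

lemma sum_incr_sign_area:
  assumes A: "\<And>k. k \<le> n \<Longrightarrow> finite_area (A k)" and "k < n" "j < n"
  shows "(\<Sum>S\<in>signatures. incr_sign k S * incr_sign j S * measure lborel (cell S)) = second_difference k j"
proof -
  have "incr_sign k S * incr_sign j S * x = of_bool (Suc k \<in> S) * of_bool (Suc j \<in> S) * x
      - of_bool (Suc k \<in> S) * of_bool (j \<in> S) * x - of_bool (k \<in> S) * of_bool (Suc j \<in> S) * x
      + of_bool (k \<in> S) * of_bool (j \<in> S) * x" for S x
    unfolding incr_sign_def by (simp only: left_diff_distrib right_diff_distrib)
  then show ?thesis
    using assms(2,3) by (simp add: second_difference_def measure_Int_cells[OF A] sum_subtractf sum.distrib)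
qed

end

context fourth_moment_levy_basis
begin

text \<open>Every increment of \<open>L \<circ> A\<close> is a combination, with entry and exit signs as coefficients, of the
independent centred values of \<open>L\<close> on the cells; the means cancel because all sets have the same
area. The sum of products of increments at distance \<open>m\<close> is therefore a quadratic form with
coefficients \<open>q c d = (\<Sum>k\<in>K. incr_sign k c * incr_sign (k - m) d)\<close>.

In its variance bound, \<open>\<bar>q c d\<bar> \<le> 2\<close> because a point enters and leaves only once, so that
\<open>(q c d)\<^sup>2\<close> is at most twice the sum of the absolute products of signs. Summing over the cells
first, the off-diagonal part becomes a sum over \<open>k\<close> of products of two areas \<open>2 g\<close> of
symmetric differences of neighbouring sets. On the diagonal, the absolute products are the negated
products, since a point of \<open>c\<close> that changes its state at both times enters first and leaves later;
their weighted sum is again a second difference of areas, and the fourth moment of a cell is at most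
proportional to its area.\<close>
lemma increment_products:
  fixes A :: "nat \<Rightarrow> (real \<times> real) set" and K :: "nat set" and n m :: nat and s g \<Lambda> :: real
  assumes A: "\<And>k. k \<le> n \<Longrightarrow> finite_area (A k)"
    and area: "\<And>k. k \<le> n \<Longrightarrow> measure lborel (A k) = \<Lambda>"
    and convex: "\<And>p i j k. i \<le> j \<Longrightarrow> j \<le> k \<Longrightarrow> k \<le> n \<Longrightarrow> p \<in> A i \<Longrightarrow> p \<in> A k \<Longrightarrow> p \<in> A j"
    and m: "m \<ge> 1" and K: "K \<subseteq> {m..<n}"
    and s: "\<And>k. k \<in> K \<Longrightarrow> second_difference A k (k - m) = - s"
    and g: "\<And>k. k < n \<Longrightarrow> second_difference A k k = 2 * g"
  defines "T \<equiv> \<lambda>\<omega>. \<Sum>k\<in>K. (L (A (Suc k)) \<omega> - L (A k) \<omega>) * (L (A (Suc (k - m))) \<omega> - L (A (k - m)) \<omega>)"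
  shows "has_bochner_integral M T (- real (card K) * s)"
    and "integrable M (\<lambda>\<omega>. (T \<omega> + real (card K) * s)\<^sup>2)"
    and "expectation (\<lambda>\<omega>. (T \<omega> + real (card K) * s)\<^sup>2)
      \<le> real (card K) * (2 * (\<bar>\<kappa>\<bar> + 3 * \<Lambda>) * s + 16 * g\<^sup>2)"
proof -
  let ?I = "signatures A n" and ?c = "cell A n" and ?\<alpha> = incr_sign
  define a where "a S = measure lborel (?c S)" for S
  define W where "W S \<omega> = L (?c S) \<omega> - expectation (L (?c S))" for S \<omega>
  define q where "q c d = (\<Sum>k\<in>K. ?\<alpha> k c * ?\<alpha> (k - m) d)" for c d
  have finI: "finite ?I" by (rule finite_signatures)
  have finK: "finite K" using K finite_subset by blast
  have fc: "finite_area (?c S)" if "S \<in> ?I" for S using finite_area_cell[OF A that] .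
  have a_nonneg: "a S \<ge> 0" for S by (simp add: a_def)
  have conv: "order_convex S" if "S \<in> ?I" for S
  proof -
    obtain k p where "S = {j \<in> {..n}. p \<in> A j}"
      using \<open>S \<in> ?I\<close> by (rule signaturesE)
    then show ?thesis using convex by (auto simp: order_convex_def)
  qed
  have a_le: "a S \<le> \<Lambda>" if S: "S \<in> ?I" for S
  proof -
    obtain k where k: "k \<in> S" "k \<le> n" using S by (rule signaturesE)
    have "?c S \<subseteq> A k" using union_cells[OF k(2), of A] S k(1) by auto
    then have "measure lborel (?c S) \<le> measure lborel (A k)"
      using A[OF k(2)] fc[OF S] by (intro measure_mono_fmeasurable) (auto simp: finite_area_def fmeasurable_def)
    then show ?thesis using area[OF k(2)] by (simp add: a_def)
  qed
  have Lm: "L (?c S) \<in> borel_measurable M" if "S \<in> ?I" for S using measurable_basis fc that by blast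
  have L4: "integrable M (\<lambda>\<omega>. L (?c S) \<omega> ^ 4)" if "S \<in> ?I" for S using basis_integrable fc that by blast
  have L1: "integrable M (L (?c S))" if "S \<in> ?I" for S
    using integrable_power_le_four[OF Lm L4, of S 1] that by simp
  have Wi: "integrable M (\<lambda>\<omega>. W S \<omega> ^ k)" if "S \<in> ?I" "k \<le> 4" for S k
    using integrable_shift_power_four[OF Lm L4, of S k "- expectation (L (?c S))"] that
    by (simp add: W_def)
  have W1: "has_bochner_integral M (W S) 0" if "S \<in> ?I" for S
    using L1[OF that] by (simp add: has_bochner_integral_iff W_def[abs_def] prob_space)
  have W2: "has_bochner_integral M (\<lambda>\<omega>. (W S \<omega>)\<^sup>2) (a S)" if "S \<in> ?I" for S
    using Wi[OF that, of 2] basis_variance[OF fc[OF that]]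
    by (simp add: has_bochner_integral_iff W_def a_def)
  have W4: "expectation (\<lambda>\<omega>. W S \<omega> ^ 4) \<le> (\<bar>\<kappa>\<bar> + 3 * \<Lambda>) * a S" if "S \<in> ?I" for S
  proof -
    have "expectation (\<lambda>\<omega>. W S \<omega> ^ 4) = (\<kappa> + 3 * a S) * a S"
      using basis_fourth_moment[OF fc[OF that]]
      by (simp add: W_def a_def power2_eq_square algebra_simps)
    also have "\<dots> \<le> (\<bar>\<kappa>\<bar> + 3 * \<Lambda>) * a S"
      using a_le[OF that] a_nonneg by (intro mult_right_mono) auto
    finally show ?thesis .
  qed
  have indW: "indep_vars (\<lambda>_. borel) W ?I"
    using indep_vars_compose2[OF indep_disjoint[OF finI fc disjoint_cells],
        of "\<lambda>S x. x - expectation (L (?c S))" "\<lambda>_. borel"]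
    by (simp add: W_def[abs_def])
  have LA: "AE \<omega> in M. \<forall>k\<in>{..n}. L (A k) \<omega> = (\<Sum>S\<in>?I. of_bool (k \<in> S) * L (?c S) \<omega>)"
  proof (rule AE_finite_allI)
    fix k assume "k \<in> {..n}"
    then have k: "k \<le> n" by simp
    have "AE \<omega> in M. L (\<Union>S\<in>{S\<in>?I. k \<in> S}. ?c S) \<omega> = (\<Sum>S\<in>{S\<in>?I. k \<in> S}. L (?c S) \<omega>)"
      using finI fc by (intro finitely_additive disjoint_cells) auto
    then show "AE \<omega> in M. L (A k) \<omega> = (\<Sum>S\<in>?I. of_bool (k \<in> S) * L (?c S) \<omega>)"
      using finI unfolding union_cells[OF k, of A, symmetric]
      by (simp add: sum.inter_filter of_bool_def if_distrib[of "\<lambda>x. x * _"] cong: if_cong)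
  qed simp
  have mean: "expectation (L (A k)) = (\<Sum>S\<in>?I. of_bool (k \<in> S) * expectation (L (?c S)))"
    if k: "k \<le> n" for k
  proof -
    have "expectation (L (A k)) = expectation (\<lambda>\<omega>. \<Sum>S\<in>?I. of_bool (k \<in> S) * L (?c S) \<omega>)"
      using LA k measurable_basis[OF A[OF k]] Lm by (intro integral_cong_AE) auto
    also have "\<dots> = (\<Sum>S\<in>?I. of_bool (k \<in> S) * expectation (L (?c S)))"
      using L1 by (subst Bochner_Integration.integral_sum) auto
    finally show ?thesis .
  qed
  have mean_const: "expectation (L (A k)) = expectation (L (A 0))" if k: "k \<le> n" for k
    using law_depends_on_area[OF A[OF k] A[of 0]] area[OF k] area[of 0]
      measurable_basis[OF A[OF k]] measurable_basis[OF A[of 0]]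
    by (intro same_law_mean prob_space_axioms) auto
  have mean_incr: "(\<Sum>S\<in>?I. ?\<alpha> k S * expectation (L (?c S))) = 0" if k: "k < n" for k
    using mean[of k] mean[of "Suc k"] mean_const[of k] mean_const[of "Suc k"] k
    by (simp add: incr_sign_def left_diff_distrib sum_subtractf)
  have incr: "AE \<omega> in M. \<forall>k\<in>{..<n}. L (A (Suc k)) \<omega> - L (A k) \<omega> = (\<Sum>S\<in>?I. ?\<alpha> k S * W S \<omega>)"
    using LA
  proof eventually_elim
    case (elim \<omega>)
    show ?case
    proof
      fix k assume "k \<in> {..<n}"
      then show "L (A (Suc k)) \<omega> - L (A k) \<omega> = (\<Sum>S\<in>?I. ?\<alpha> k S * W S \<omega>)"
        using elim mean_incr[of k]
        by (simp add: W_def right_diff_distrib sum_subtractf incr_sign_def left_diff_distrib)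
    qed
  qed
  have q_trace: "(\<Sum>c\<in>?I. q c c * a c) = - real (card K) * s"
  proof -
    have "(\<Sum>c\<in>?I. q c c * a c) = (\<Sum>k\<in>K. \<Sum>c\<in>?I. ?\<alpha> k c * ?\<alpha> (k - m) c * a c)"
      unfolding q_def sum_distrib_right by (rule sum.swap)
    also have "\<dots> = (\<Sum>k\<in>K. second_difference A k (k - m))"
      using K by (intro sum.cong refl) (force simp: a_def intro!: sum_incr_sign_area A)
    finally show ?thesis using s by simp
  qed
  define H where "H \<omega> = (\<Sum>c\<in>?I. \<Sum>d\<in>?I. q c d * (W c \<omega> * W d \<omega>)) - (\<Sum>c\<in>?I. q c c * a c)" for \<omega>
  have TH: "AE \<omega> in M. T \<omega> + real (card K) * s = H \<omega>"
    using incr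
  proof eventually_elim
    case (elim \<omega>)
    have "T \<omega> = (\<Sum>k\<in>K. (\<Sum>c\<in>?I. ?\<alpha> k c * W c \<omega>) * (\<Sum>d\<in>?I. ?\<alpha> (k - m) d * W d \<omega>))"
      unfolding T_def using elim K by (intro sum.cong refl) (force intro!: arg_cong2[where f = "(*)"])
    also have "\<dots> = (\<Sum>k\<in>K. \<Sum>c\<in>?I. \<Sum>d\<in>?I. ?\<alpha> k c * ?\<alpha> (k - m) d * (W c \<omega> * W d \<omega>))"
      by (simp add: sum_product algebra_simps)
    also have "\<dots> = (\<Sum>c\<in>?I. \<Sum>d\<in>?I. q c d * (W c \<omega> * W d \<omega>))"
      unfolding q_def sum_distrib_right
      by (subst sum.swap, intro sum.cong refl, rule sum.swap)
    finally show ?case using q_trace by (simp add: H_def)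
  qed
  have Hmom: "has_bochner_integral M H 0" "integrable M (\<lambda>\<omega>. (H \<omega>)\<^sup>2)"
    "expectation (\<lambda>\<omega>. (H \<omega>)\<^sup>2) \<le> (\<Sum>c\<in>?I. (q c c)\<^sup>2 * expectation (\<lambda>\<omega>. W c \<omega> ^ 4))
      + 2 * (\<Sum>c\<in>?I. \<Sum>d\<in>?I. (q c d)\<^sup>2 * (a c * a d))"
    unfolding H_def
    using quadratic_form_moments[OF finI indW, of a q] W1 W2 Wi[of _ 4] by auto
  have LAm: "L (A k) \<in> borel_measurable M" if "k \<le> n" for k using measurable_basis A that by blast
  have Tm: "T \<in> borel_measurable M"
    unfolding T_def using K
    by (intro borel_measurable_sum borel_measurable_times borel_measurable_diff LAm) force+
  have Hm: "H \<in> borel_measurable M" using Hmom(1)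
    by (auto simp: has_bochner_integral_iff intro: borel_measurable_integrable)
  have "has_bochner_integral M (\<lambda>\<omega>. T \<omega> + real (card K) * s) 0"
    using Hmom(1) TH Tm Hm by (subst has_bochner_integral_cong_AE[where g = H]) auto
  from has_bochner_integral_diff[OF this, of "\<lambda>_. real (card K) * s" "real (card K) * s"]
  show "has_bochner_integral M T (- real (card K) * s)"
    by (simp add: has_bochner_integral_iff prob_space)
  have sqAE: "AE \<omega> in M. (T \<omega> + real (card K) * s)\<^sup>2 = (H \<omega>)\<^sup>2" using TH by auto
  show "integrable M (\<lambda>\<omega>. (T \<omega> + real (card K) * s)\<^sup>2)"
    using Hmom(2) sqAE Tm Hm by (subst integrable_cong_AE[where g = "\<lambda>\<omega>. (H \<omega>)\<^sup>2"]) auto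
  have q_abs: "\<bar>q c d\<bar> \<le> (\<Sum>k\<in>K. \<bar>?\<alpha> k c\<bar> * \<bar>?\<alpha> (k - m) d\<bar>)" for c d
    unfolding q_def by (rule order_trans[OF sum_abs]) (simp add: abs_mult)
  have \<alpha>_le: "\<bar>?\<alpha> k S\<bar> \<le> 1" for k S by (simp add: incr_sign_def)
  have q_sq: "(q c d)\<^sup>2 \<le> 2 * (\<Sum>k\<in>K. \<bar>?\<alpha> k c\<bar> * \<bar>?\<alpha> (k - m) d\<bar>)" if c: "c \<in> ?I" for c d
  proof -
    have "(\<Sum>k\<in>K. \<bar>?\<alpha> k c\<bar> * \<bar>?\<alpha> (k - m) d\<bar>) \<le> (\<Sum>k\<in>K. \<bar>?\<alpha> k c\<bar>)"
      using \<alpha>_le by (intro sum_mono mult_left_le) auto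
    also have "\<dots> \<le> 2" using sum_incr_sign_le[OF conv[OF c] finK] .
    finally have "\<bar>q c d\<bar> \<le> 2" using q_abs[of c d] by linarith
    then have "\<bar>q c d\<bar> * \<bar>q c d\<bar> \<le> 2 * \<bar>q c d\<bar>" by (intro mult_right_mono) auto
    then show ?thesis using q_abs[of c d] by (simp add: power2_eq_square)
  qed
  have "(\<Sum>c\<in>?I. (q c c)\<^sup>2 * expectation (\<lambda>\<omega>. W c \<omega> ^ 4))
      \<le> (\<Sum>c\<in>?I. (2 * (\<Sum>k\<in>K. \<bar>?\<alpha> k c\<bar> * \<bar>?\<alpha> (k - m) c\<bar>)) * ((\<bar>\<kappa>\<bar> + 3 * \<Lambda>) * a c))"
    by (intro sum_mono mult_mono q_sq W4) (auto intro!: sum_nonneg Bochner_Integration.integral_nonneg)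
  also have "\<dots> = 2 * (\<bar>\<kappa>\<bar> + 3 * \<Lambda>) * (\<Sum>c\<in>?I. \<Sum>k\<in>K. \<bar>?\<alpha> k c\<bar> * \<bar>?\<alpha> (k - m) c\<bar> * a c)"
    by (simp add: sum_distrib_left sum_distrib_right algebra_simps)
  also have "(\<Sum>c\<in>?I. \<Sum>k\<in>K. \<bar>?\<alpha> k c\<bar> * \<bar>?\<alpha> (k - m) c\<bar> * a c)
      = (\<Sum>c\<in>?I. \<Sum>k\<in>K. - (?\<alpha> k c * ?\<alpha> (k - m) c * a c))"
  proof (intro sum.cong refl)
    fix c k assume ck: "c \<in> ?I" "k \<in> K"
    have "?\<alpha> k c * ?\<alpha> (k - m) c \<le> 0"
      using ck K m by (intro incr_sign_product_nonpos conv) auto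
    then have "\<bar>?\<alpha> k c\<bar> * \<bar>?\<alpha> (k - m) c\<bar> = - (?\<alpha> k c * ?\<alpha> (k - m) c)"
      by (simp add: abs_mult[symmetric])
    then show "\<bar>?\<alpha> k c\<bar> * \<bar>?\<alpha> (k - m) c\<bar> * a c = - (?\<alpha> k c * ?\<alpha> (k - m) c * a c)" by simp
  qed
  also have "\<dots> = - (\<Sum>c\<in>?I. q c c * a c)"
    by (simp add: q_def sum_distrib_right sum_negf)
  finally have diag: "(\<Sum>c\<in>?I. (q c c)\<^sup>2 * expectation (\<lambda>\<omega>. W c \<omega> ^ 4))
      \<le> 2 * (\<bar>\<kappa>\<bar> + 3 * \<Lambda>) * (real (card K) * s)"
    using q_trace by simp
  have abs_area: "(\<Sum>c\<in>?I. \<bar>?\<alpha> k c\<bar> * a c) = 2 * g" if k: "k < n" for k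
  proof -
    have "\<bar>?\<alpha> k c\<bar> = ?\<alpha> k c * ?\<alpha> k c" for c by (simp add: incr_sign_def)
    then show ?thesis using sum_incr_sign_area[OF A k k] g[OF k] by (simp add: a_def)
  qed
  have "(\<Sum>c\<in>?I. \<Sum>d\<in>?I. (q c d)\<^sup>2 * (a c * a d))
      \<le> (\<Sum>c\<in>?I. \<Sum>d\<in>?I. (2 * (\<Sum>k\<in>K. \<bar>?\<alpha> k c\<bar> * \<bar>?\<alpha> (k - m) d\<bar>)) * (a c * a d))"
    using a_nonneg by (intro sum_mono mult_right_mono q_sq) auto
  also have "\<dots> = 2 * (\<Sum>c\<in>?I. \<Sum>d\<in>?I. \<Sum>k\<in>K. (\<bar>?\<alpha> k c\<bar> * a c) * (\<bar>?\<alpha> (k - m) d\<bar> * a d))"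
    by (simp add: sum_distrib_left sum_distrib_right algebra_simps)
  also have "(\<Sum>c\<in>?I. \<Sum>d\<in>?I. \<Sum>k\<in>K. (\<bar>?\<alpha> k c\<bar> * a c) * (\<bar>?\<alpha> (k - m) d\<bar> * a d))
      = (\<Sum>k\<in>K. \<Sum>c\<in>?I. \<Sum>d\<in>?I. (\<bar>?\<alpha> k c\<bar> * a c) * (\<bar>?\<alpha> (k - m) d\<bar> * a d))"
    by (subst (2) sum.swap, subst sum.swap, rule refl)
  also have "\<dots> = (\<Sum>k\<in>K. (\<Sum>c\<in>?I. \<bar>?\<alpha> k c\<bar> * a c) * (\<Sum>d\<in>?I. \<bar>?\<alpha> (k - m) d\<bar> * a d))"
    by (simp add: sum_product)
  also have "\<dots> = (\<Sum>k\<in>K. (2 * g) * (2 * g))"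
    using K by (intro sum.cong refl arg_cong2[where f = "(*)"] abs_area) force+
  also have "\<dots> = real (card K) * (4 * g\<^sup>2)" by (simp add: power2_eq_square)
  finally have off: "2 * (\<Sum>c\<in>?I. \<Sum>d\<in>?I. (q c d)\<^sup>2 * (a c * a d)) \<le> real (card K) * (16 * g\<^sup>2)"
    by simp
  have "expectation (\<lambda>\<omega>. (T \<omega> + real (card K) * s)\<^sup>2) = expectation (\<lambda>\<omega>. (H \<omega>)\<^sup>2)"
    using sqAE Tm Hm by (intro integral_cong_AE) auto
  also have "\<dots> \<le> 2 * (\<bar>\<kappa>\<bar> + 3 * \<Lambda>) * (real (card K) * s) + real (card K) * (16 * g\<^sup>2)"
    using Hmom(3) diag off by linarith
  finally show "expectation (\<lambda>\<omega>. (T \<omega> + real (card K) * s)\<^sup>2)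
      \<le> real (card K) * (2 * (\<bar>\<kappa>\<bar> + 3 * \<Lambda>) * s + 16 * g\<^sup>2)"
    by (simp add: algebra_simps)
qed

end

section \<open>Tail integrals and their second differences\<close>

lemma tail_integral_has_derivative:
  fixes f F :: "real \<Rightarrow> real"
  assumes cont: "continuous_on {0..} f" and int: "set_integrable lborel {0..} f"
    and F: "\<And>s. s \<ge> 0 \<Longrightarrow> F s = set_lebesgue_integral lborel {s..} f" and t: "t \<ge> 0"
  shows "(F has_real_derivative - f t) (at t within {0..})"
proof -
  have hk: "f integrable_on {s..}" "F s = integral {s..} f" if "s \<ge> 0" for s
  proof -
    have "set_integrable lborel {s..} f"
      using that by (intro set_integrable_subset[OF int]) auto
    from set_borel_integral_eq_integral[OF this] F[OF that]
    show "f integrable_on {s..}" "F s = integral {s..} f" by auto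
  qed
  have split: "F s = F 0 - integral {0..s} f" if "s \<ge> 0" for s
  proof -
    have "f integrable_on {0..s}"
      using cont that by (intro integrable_continuous_interval continuous_on_subset[OF cont]) auto
    moreover have "{0..s} \<inter> {s..} = {s}" "{0..s} \<union> {s..} = {0..}" using that by auto
    ultimately have "integral {0..} f = integral {0..s} f + integral {s..} f"
      using integral_Un[of f "{0..s}" "{s..}"] hk(1)[OF that] by simp
    then show ?thesis using hk(2)[OF that] hk(2)[of 0] by simp
  qed
  have "((\<lambda>s. integral {0..s} f) has_real_derivative f t) (at t within {0..t + 1})"
    using t by (intro integral_has_real_derivative continuous_on_subset[OF cont]) auto
  moreover have "at t within {0..t + 1} = at t within {0..}"
    by (rule at_within_nhd[of t "{t - 1<..<t + 1}"]) auto
  ultimately have "((\<lambda>s. F 0 - integral {0..s} f) has_real_derivative 0 - f t) (at t within {0..})"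
    by (intro DERIV_diff) auto
  then have "(F has_real_derivative 0 - f t) (at t within {0..})"
    by (rule has_field_derivative_transform_within[where d = 1]) (use t in \<open>auto simp: split[symmetric]\<close>)
  then show ?thesis by simp
qed

lemma has_real_derivative_at_of_half_line:
  fixes F :: "real \<Rightarrow> real"
  assumes "(F has_real_derivative D) (at x within {0..})" "x > 0"
  shows "(F has_real_derivative D) (at x)"
proof -
  have "at x within {0..} = at x"
    using assms(2) by (intro at_within_interior) auto
  then show ?thesis using assms(1) by simp
qed

lemma mean_value_half_line:
  fixes F :: "real \<Rightarrow> real"
  assumes "\<And>x. x \<ge> 0 \<Longrightarrow> (F has_real_derivative F' x) (at x within {0..})" "u \<ge> 0" "u < v"
  obtains \<xi> where "u < \<xi>" "\<xi> < v" "F v - F u = (v - u) * F' \<xi>"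
proof -
  have "(F has_derivative (\<lambda>h. h * F' x)) (at x within {u..v})" if "x \<in> {u..v}" for x
    using assms that
    by (intro has_derivative_subset[of F _ x "{0..}" "{u..v}"])
      (auto simp: has_field_derivative_def mult.commute[of _ "F' x"])
  from mvt_simple[OF assms(3) this] that show ?thesis by auto
qed

text \<open>The mean value theorem is applied to \<open>G (x + d) - G x\<close> and then to \<open>a\<close>.
The point found second lies at most one step to the right of the first, hence within two steps of \<open>u\<close>.\<close>
lemma second_difference_mean_value:
  fixes G a \<phi> :: "real \<Rightarrow> real"
  assumes G: "\<And>x. x \<ge> 0 \<Longrightarrow> (G has_real_derivative - a x) (at x within {0..})"
    and a: "\<And>x. x \<ge> 0 \<Longrightarrow> (a has_real_derivative - \<phi> x) (at x within {0..})"
    and u: "u \<ge> 0" and d: "d > 0"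
  obtains \<xi> where "u < \<xi>" "\<xi> < u + 2 * d" "G u - 2 * G (u + d) + G (u + 2 * d) = d\<^sup>2 * \<phi> \<xi>"
proof -
  have "((\<lambda>x. G (x + d) - G x) has_real_derivative (a x - a (x + d))) (at x within {0..})" if x: "x \<ge> 0" for x
  proof -
    have "(G has_real_derivative - a (x + d)) (at (x + d))"
      using G x d by (intro has_real_derivative_at_of_half_line) auto
    moreover have "((\<lambda>x. x + d) has_real_derivative 1) (at x within {0..})"
      by (auto intro!: derivative_eq_intros)
    ultimately have "((\<lambda>x. G (x + d)) has_real_derivative - a (x + d) * 1) (at x within {0..})"
      by (intro DERIV_chain'[of "\<lambda>x. x + d" 1 x "{0..}" G])
    from DERIV_diff[OF this G[OF x]] show ?thesis by simp
  qed
  then obtain \<xi> where \<xi>: "u < \<xi>" "\<xi> < u + d"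
    "G (u + d + d) - G (u + d) - (G (u + d) - G u) = d * (a \<xi> - a (\<xi> + d))"
    by (rule mean_value_half_line[of _ _ u "u + d"]) (use u d in auto)
  obtain \<eta> where \<eta>: "\<xi> < \<eta>" "\<eta> < \<xi> + d" "a (\<xi> + d) - a \<xi> = d * (- \<phi> \<eta>)"
    by (rule mean_value_half_line[OF a, of \<xi> "\<xi> + d"]) (use u d \<xi> in auto)
  show ?thesis
  proof (rule that[of \<eta>])
    have "a \<xi> - a (\<xi> + d) = d * \<phi> \<eta>" using \<eta>(3) by simp
    then show "G u - 2 * G (u + d) + G (u + 2 * d) = d\<^sup>2 * \<phi> \<eta>"
      using \<xi>(3) by (simp add: power2_eq_square algebra_simps)
  qed (use \<xi> \<eta> in auto)
qed

lemma power_decay_integrable: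
  fixes f :: "real \<Rightarrow> real"
  assumes cont: "continuous_on {0..} f" and big: "f \<in> O[at_top](\<lambda>s. s powr (- p))" and p: "p > 1"
  shows "set_integrable lborel {0..} f"
proof -
  obtain c where "eventually (\<lambda>s. norm (f s) \<le> c * norm (s powr (- p))) at_top"
    using big by (rule landau_o.bigE)
  then obtain b0 where b0: "\<And>s. s \<ge> b0 \<Longrightarrow> norm (f s) \<le> c * norm (s powr (- p))"
    by (auto simp: eventually_at_top_linorder)
  define b where "b = max b0 1"
  have b: "b \<ge> 1" "b \<ge> b0" by (auto simp: b_def)
  have "(\<lambda>s. s powr (- p)) absolutely_integrable_on {b..}"
    using has_integral_powr_to_inf[of "- p" b] p b
    by (intro nonnegative_absolutely_integrable_1) (auto simp: integrable_on_def)
  then have "set_integrable lborel {b..} (\<lambda>s. s powr (- p))"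
    unfolding set_integrable_def by (subst (asm) integrable_completion) auto
  then have "set_integrable lborel {b..} (\<lambda>s. c * s powr (- p))"
    by simp
  then have tail: "set_integrable lborel {b..} f"
    unfolding set_integrable_def
  proof (rule Bochner_Integration.integrable_bound)
    have "continuous_on {b..} f" using b by (intro continuous_on_subset[OF cont]) auto
    then show "(\<lambda>x. indicat_real {b..} x *\<^sub>R f x) \<in> borel_measurable lborel"
      using borel_measurable_continuous_on_indicator[of "{b..}" f] by simp
    have "\<bar>f x\<bar> \<le> \<bar>c * x powr (- p)\<bar>" if "x \<ge> b" for x
      using b0[of x] that b by simp
    then show "AE x in lborel. norm (indicat_real {b..} x *\<^sub>R f x) \<le> norm (indicat_real {b..} x *\<^sub>R (c * x powr (- p)))"
      by (auto simp: indicator_def)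
  qed
  have "set_integrable lborel {0..b} f"
    by (intro borel_integrable_atLeastAtMost' continuous_on_subset[OF cont]) auto
  moreover have "{0..} = {0..b} \<union> {b..}" using b by auto
  ultimately show ?thesis using set_integrable_Un[OF _ tail, of "{0..b}"] by simp
qed

section \<open>Geometry of trawl sets\<close>

definition shifted_trawl :: "(real \<Rightarrow> real) \<Rightarrow> real \<Rightarrow> (real \<times> real) set" where
  "shifted_trawl a t = (\<lambda>p. p + (t, 0)) ` trawl_set a"

text \<open>The area common to two trawl sets whose positions differ by \<open>h\<close>: it is the autocovariance function of the
trawl process when the seed has unit variance.\<close>
definition overlap_area :: "(real \<Rightarrow> real) \<Rightarrow> real \<Rightarrow> real" where
  "overlap_area a h = set_lebesgue_integral lborel {h..} a"

lemma mem_shifted_trawl: "(r, y) \<in> shifted_trawl a t \<longleftrightarrow> r \<le> t \<and> 0 \<le> y \<and> y \<le> a (t - r)"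
proof
  assume "r \<le> t \<and> 0 \<le> y \<and> y \<le> a (t - r)"
  then have "(r - t, y) \<in> trawl_set a" by (simp add: trawl_set_def)
  then show "(r, y) \<in> shifted_trawl a t" unfolding shifted_trawl_def by (force intro: rev_image_eqI)
qed (auto simp: shifted_trawl_def trawl_set_def)

context
  fixes a :: "real \<Rightarrow> real"
  assumes trawl: "trawl_function a"
begin

lemma trawl_nonneg: "s \<ge> 0 \<Longrightarrow> a s \<ge> 0"
  and trawl_antimono: "0 \<le> r \<Longrightarrow> r \<le> s \<Longrightarrow> a s \<le> a r"
  and trawl_continuous: "continuous_on {0..} a"
  and trawl_integrable: "set_integrable lborel {0..} a"
  using trawl by (auto simp: trawl_function_def monotone_on_def)

text \<open>Monotonicity of the trawl function makes the times at which a point belongs to the moving trawl set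
an interval.\<close>
lemma shifted_trawl_convex:
  assumes "r \<le> s" "s \<le> t" "p \<in> shifted_trawl a r" "p \<in> shifted_trawl a t"
  shows "p \<in> shifted_trawl a s"
  using assms trawl_antimono[of "s - fst p" "t - fst p"]
  by (cases p) (auto simp: mem_shifted_trawl)

text \<open>The trawl function is constrained only on the half-line; extending it by its value at 0 gives
a continuous, hence Borel measurable, function on the real line.\<close>
lemma continuous_extension: "continuous_on UNIV (\<lambda>x. a (max 0 x))"
  by (rule continuous_on_compose2[OF trawl_continuous, of UNIV "\<lambda>x. max 0 x"])
    (auto intro!: continuous_intros)

lemma borel_shifted_trawl: "shifted_trawl a t \<in> sets borel"
proof -
  have "shifted_trawl a t = {p. fst p \<le> t} \<inter> {p. 0 \<le> snd p} \<inter> {p. snd p \<le> a (max 0 (t - fst p))}"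
    by (auto simp: mem_shifted_trawl max_def)
  moreover have "continuous_on UNIV (\<lambda>p::real \<times> real. a (max 0 (t - fst p)))"
    by (rule continuous_on_compose2[OF continuous_extension, of UNIV "\<lambda>p. t - fst p"])
      (auto intro!: continuous_intros)
  then have "closed ({p. fst p \<le> t} \<inter> {p. 0 \<le> snd p} \<inter> {p. snd p \<le> a (max 0 (t - fst p))})"
    by (intro closed_Int closed_Collect_le) (auto intro!: continuous_intros)
  ultimately show ?thesis by (simp add: borel_closed)
qed

text \<open>The later set has the lower upper boundary, so the intersection is the part of the later set lying
to the left of \<open>s\<close>; the substitution \<open>r = t - u\<close> turns its area into a tail integral.\<close>
lemma emeasure_shifted_trawl_Int:
  assumes "s \<le> t"
  shows "emeasure lborel (shifted_trawl a s \<inter> shifted_trawl a t) = ennreal (overlap_area a (t - s))"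
proof -
  let ?X = "shifted_trawl a s \<inter> shifted_trawl a t" and ?a = "\<lambda>x. a (max 0 x)"
  have am[measurable]: "?a \<in> borel_measurable borel"
    using continuous_extension by (rule borel_measurable_continuous_onI)
  have X: "?X \<in> sets (lborel \<Otimes>\<^sub>M lborel)"
    using borel_shifted_trawl unfolding lborel_prod by auto
  have slice: "emeasure lborel (Pair r -` ?X) = ennreal (?a (t - r)) * indicator {..s} r" for r
  proof (cases "r \<le> s")
    case True
    have "a (t - r) \<le> a (s - r)" using True assms by (intro trawl_antimono) auto
    then have "Pair r -` ?X = {0..a (t - r)}" using True assms by (auto simp: mem_shifted_trawl)
    then show ?thesis using True assms trawl_nonneg[of "t - r"] by (simp add: max_def)
  next
    case False
    then have "Pair r -` ?X = {}" by (auto simp: mem_shifted_trawl)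
    then show ?thesis using False by simp
  qed
  have int: "set_integrable lborel {t - s..} a"
    using assms by (intro set_integrable_subset[OF trawl_integrable]) auto
  have "emeasure lborel ?X = (\<integral>\<^sup>+r. ennreal (?a (t - r)) * indicator {..s} r \<partial>lborel)"
    unfolding lborel_prod[symmetric] by (subst lborel.emeasure_pair_measure_alt[OF X]) (simp only: slice)
  also have "\<dots> = (\<integral>\<^sup>+u. ennreal (?a u) * indicator {..s} (t - u) \<partial>lborel)"
    by (subst nn_integral_real_affine[where c = "- 1" and t = t]) auto
  also have "\<dots> = (\<integral>\<^sup>+u. ennreal (indicator {t - s..} u *\<^sub>R a u) \<partial>lborel)"
    using assms by (intro nn_integral_cong) (auto simp: indicator_def max_def)
  also have "\<dots> = ennreal (overlap_area a (t - s))"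
    unfolding overlap_area_def set_lebesgue_integral_def
    using int assms trawl_nonneg
    by (intro nn_integral_eq_integral) (auto simp: set_integrable_def indicator_def)
  finally show ?thesis .
qed

lemma overlap_area_nonneg: "h \<ge> 0 \<Longrightarrow> overlap_area a h \<ge> 0"
  unfolding overlap_area_def set_lebesgue_integral_def
  using trawl_nonneg by (intro Bochner_Integration.integral_nonneg) (auto simp: indicator_def)

lemma measure_shifted_trawl_Int:
  assumes "s \<le> t"
  shows "measure lborel (shifted_trawl a s \<inter> shifted_trawl a t) = overlap_area a (t - s)"
  using emeasure_shifted_trawl_Int[OF assms] overlap_area_nonneg[of "t - s"] assms
  by (simp add: measure_def)

lemma finite_area_shifted_trawl: "finite_area (shifted_trawl a t)"
  using emeasure_shifted_trawl_Int[of t t] borel_shifted_trawl by (simp add: finite_area_def)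

lemma overlap_area_has_derivative:
  "x \<ge> 0 \<Longrightarrow> (overlap_area a has_real_derivative - a x) (at x within {0..})"
  by (rule tail_integral_has_derivative[OF trawl_continuous trawl_integrable])
    (simp_all add: overlap_area_def)

end

text \<open>The absolute value covers the case \<open>j = k\<close>, where the two neighbouring overlaps agree by symmetry.\<close>
lemma second_difference_shifted_trawl:
  assumes trawl: "trawl_function a" and d: "d > 0" and "j \<le> k"
  shows "second_difference (\<lambda>k. shifted_trawl a (real k * d)) k j =
    2 * overlap_area a (real (k - j) * d) - overlap_area a (real (k - j + 1) * d)
    - overlap_area a (\<bar>real (k - j) - 1\<bar> * d)"
proof -
  let ?A = "\<lambda>k. shifted_trawl a (real k * d)"
  have I: "measure lborel (?A i \<inter> ?A l) = overlap_area a (\<bar>real i - real l\<bar> * d)" for i l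
  proof (cases "i \<le> l")
    case True
    then show ?thesis
      using measure_shifted_trawl_Int[OF trawl, of "real i * d" "real l * d"] d
      by (simp add: left_diff_distrib)
  next
    case False
    then show ?thesis
      using measure_shifted_trawl_Int[OF trawl, of "real l * d" "real i * d"] d
      by (simp add: left_diff_distrib Int_commute)
  qed
  have "\<bar>real (Suc k) - real (Suc j)\<bar> = real (k - j)" "\<bar>real (Suc k) - real j\<bar> = real (k - j + 1)"
    "\<bar>real k - real (Suc j)\<bar> = \<bar>real (k - j) - 1\<bar>" "\<bar>real k - real j\<bar> = real (k - j)"
    using \<open>j \<le> k\<close> by (simp_all add: of_nat_diff)
  then have "second_difference ?A k j = overlap_area a (real (k - j) * d)
      - overlap_area a (real (k - j + 1) * d) - overlap_area a (\<bar>real (k - j) - 1\<bar> * d)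
      + overlap_area a (real (k - j) * d)"
    unfolding second_difference_def I by (simp only:)
  then show ?thesis by linarith
qed

section \<open>The estimator of the trawl derivative\<close>

text \<open>The seed has the law of the basis on a set of area 1, by uniqueness of characteristic functions.\<close>
lemma (in homogeneous_levy_basis) fourth_moment_basis_of_seed:
  assumes "levy_seed N L' \<gamma> b \<nu>" and var: "prob_space.variance N L' = 1"
    and p: "p > 4" and mom: "integrable N (\<lambda>\<omega>. \<bar>L' \<omega>\<bar> powr p)"
  shows "fourth_moment_levy_basis M L \<gamma> b \<nu>"
proof -
  interpret N: levy_seed N L' \<gamma> b \<nu> by fact
  note m = N.measurable_seed measurable_basis[OF strip_area(1)[of 0 1]]
  have law: "distr M borel (L (strip 0 1)) = distr N borel L'"
  proof (rule Levy_uniqueness)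
    show "real_distribution (distr M borel (L (strip 0 1)))" "real_distribution (distr N borel L')"
      using m by (auto intro: real_distribution_distr N.real_distribution_distr)
    show "char (distr M borel (L (strip 0 1))) = char (distr N borel L')"
      using char_basis[OF strip_area(1)[of 0 1]] by (auto simp: strip_area N.char_seed)
  qed
  have "integrable N (\<lambda>\<omega>. L' \<omega> ^ 4)"
  proof (rule Bochner_Integration.integrable_bound)
    show "integrable N (\<lambda>\<omega>. 1 + \<bar>L' \<omega>\<bar> powr p)" using mom by simp
    have "x ^ 4 \<le> 1 + \<bar>x\<bar> powr p" for x :: real
    proof (cases "\<bar>x\<bar> \<le> 1")
      case True
      then show ?thesis using power_le_one[of "\<bar>x\<bar>" 4] by (simp add: add_increasing2)
    next
      case False
      then have "\<bar>x\<bar> powr 4 \<le> \<bar>x\<bar> powr p" using p by (intro powr_mono) auto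
      moreover have "\<bar>x\<bar> powr 4 = x ^ 4" using False by (subst powr_numeral) auto
      ultimately show ?thesis by linarith
    qed
    then show "AE \<omega> in N. norm (L' \<omega> ^ 4) \<le> norm (1 + \<bar>L' \<omega>\<bar> powr p)" by simp
  qed (use m in simp)
  then have "integrable M (\<lambda>\<omega>. L (strip 0 1) \<omega> ^ 4)"
    using same_law_integrable[OF _ N.prob_space_axioms _ law, of "\<lambda>x. x ^ 4"] m by simp
  moreover have "variance (L (strip 0 1)) = 1"
    using same_law_variance[OF _ N.prob_space_axioms _ law] m var by simp
  ultimately show ?thesis by unfold_locales
qed

theorem proposition1:
  fixes M :: "'a measure" and N :: "'b measure"
    and L :: "(real \<times> real) set \<Rightarrow> 'a \<Rightarrow> real" and L' :: "'b \<Rightarrow> real"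
    and \<gamma> b :: real and \<nu> :: "real measure"
    and a \<phi> :: "real \<Rightarrow> real" and \<alpha> p\<^sub>0 :: real
    and X :: "real \<Rightarrow> 'a \<Rightarrow> real"
    and \<Delta> :: "nat \<Rightarrow> real" and \<mu> :: ennreal
  assumes basis: "homogeneous_levy_basis M L \<gamma> b \<nu>"
    and seed: "levy_seed N L' \<gamma> b \<nu>"
    and trawl: "trawl_function a"
    and X: "X = trawl_process a L"
    and \<Delta>_pos: "\<And>n. \<Delta> n > 0"
    and \<Delta>_lim: "\<Delta> \<longlonglongrightarrow> 0"
    and horizon: "filterlim (\<lambda>n. real n * \<Delta> n) at_top sequentially"
    and \<mu>_lim: "(\<lambda>n. ennreal (real n * \<Delta> n ^ 3)) \<longlonglongrightarrow> \<mu>"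
    and a_eq: "\<And>s. s \<ge> 0 \<Longrightarrow> a s = set_lebesgue_integral lborel {s..} \<phi>"
    and \<phi>_pos: "\<And>s. s \<ge> 0 \<Longrightarrow> \<phi> s > 0"
    and \<phi>_cont: "continuous_on {0..} \<phi>"
    and \<alpha>: "\<alpha> > 1"
    and \<phi>_bigo: "\<phi> \<in> O[at_top](\<lambda>s. s powr (- \<alpha> - 1))"
    and seed_var: "prob_space.variance N L' = 1"
    and p\<^sub>0: "p\<^sub>0 > 4"
    and seed_moment: "integrable N (\<lambda>\<omega>. \<bar>L' \<omega>\<bar> powr p\<^sub>0)"
  shows "\<forall>t\<ge>0. \<exists>(R :: nat \<Rightarrow> 'a \<Rightarrow> real) (e :: nat \<Rightarrow> real).
           O_prob M R (\<lambda>n. 1 / sqrt (real n * (\<Delta> n)\<^sup>2)) \<and>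
           e \<in> o(\<lambda>_. 1) \<and>
           (\<forall>n. \<forall>\<omega>\<in>space M. trawl_deriv_estimator X n (\<Delta> n) t \<omega> =
              vector_derivative a (at t within {0..}) + R n \<omega> + e n)"
proof (intro allI impI)
  fix t :: real assume t: "t \<ge> 0"
  interpret homogeneous_levy_basis M L \<gamma> b \<nu> by (rule basis)
  interpret fourth_moment_levy_basis M L \<gamma> b \<nu>
    using fourth_moment_basis_of_seed[OF seed seed_var p\<^sub>0 seed_moment] .
  let ?G = "overlap_area a"
  have \<phi>_int: "set_integrable lborel {0..} \<phi>"
    using power_decay_integrable[OF \<phi>_cont, of "\<alpha> + 1"] \<phi>_bigo \<alpha> by simp
  have a': "(a has_real_derivative - \<phi> x) (at x within {0..})" if "x \<ge> 0" for x
    using tail_integral_has_derivative[OF \<phi>_cont \<phi>_int a_eq that] .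
  note G' = overlap_area_has_derivative[OF trawl]
  have deriv: "vector_derivative a (at t within {0..}) = - \<phi> t"
  proof (rule vector_derivative_within)
    have "at_right t \<le> at t within {0..}" using t by (intro at_le) auto
    then show "at t within {0..} \<noteq> bot"
      by (metis bot.extremum_uniqueI trivial_limit_at_right_real)
    show "(a has_vector_derivative - \<phi> t) (at t within {0..})"
      using a'[OF t] by (simp add: has_real_derivative_iff_has_vector_derivative)
  qed
  \<comment> \<open>The process is observed on the grid of multiples of \<open>\<Delta> n\<close>; \<open>u n\<close> is the grid point
    just below \<open>t\<close>, \<open>- s n\<close> the covariance of the two increments in each summand of the
    estimator, and \<open>2 * g n\<close> the variance of one increment.\<close>
  define l where "l n = lag (\<Delta> n) t" for n
  define K where "K n = {l n + 1..n - 2}" for n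
  define u where "u n = real (l n) * \<Delta> n" for n
  define s where "s n = ?G (u n) - 2 * ?G (u n + \<Delta> n) + ?G (u n + 2 * \<Delta> n)" for n
  define g where "g n = ?G 0 - ?G (\<Delta> n)" for n
  define A where "A n k = shifted_trawl a (real k * \<Delta> n)" for n k
  define T where "T n \<omega> = (\<Sum>k\<in>K n. (L (A n (Suc k)) \<omega> - L (A n k) \<omega>) *
    (L (A n (Suc (k - (l n + 1)))) \<omega> - L (A n (k - (l n + 1))) \<omega>))" for n \<omega>
  have u: "0 \<le> u n" "u n \<le> t" "t < u n + \<Delta> n" for n
  proof -
    have "u n = of_int \<lfloor>t / \<Delta> n\<rfloor> * \<Delta> n"
      using lag_eq_floor[OF \<Delta>_pos t] \<Delta>_pos[of n] t by (simp add: u_def l_def)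
    moreover have "of_int \<lfloor>t / \<Delta> n\<rfloor> * \<Delta> n \<le> t / \<Delta> n * \<Delta> n"
        "t / \<Delta> n * \<Delta> n < (of_int \<lfloor>t / \<Delta> n\<rfloor> + 1) * \<Delta> n"
      using \<Delta>_pos[of n] by (intro mult_right_mono mult_strict_right_mono; linarith)+
    ultimately show "u n \<le> t" "t < u n + \<Delta> n"
      using \<Delta>_pos[of n] by (simp_all add: distrib_right)
    show "0 \<le> u n" using \<Delta>_pos[of n] by (simp add: u_def)
  qed
  have est: "trawl_deriv_estimator X n (\<Delta> n) t \<omega> = T n \<omega> / (real n * (\<Delta> n)\<^sup>2)" for n \<omega>
    by (simp add: trawl_deriv_estimator_def T_def K_def l_def X trawl_process_def increment_def
        A_def shifted_trawl_def add.commute)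

  have "\<exists>\<xi>. u n < \<xi> \<and> \<xi> < u n + 2 * \<Delta> n \<and> s n = (\<Delta> n)\<^sup>2 * \<phi> \<xi>" for n
    using second_difference_mean_value[OF G' a' u(1) \<Delta>_pos, of n n] unfolding s_def by metis
  then obtain \<xi> where \<xi>: "u n < \<xi> n" "\<xi> n < u n + 2 * \<Delta> n" "s n = (\<Delta> n)\<^sup>2 * \<phi> (\<xi> n)" for n
    by metis
  have "\<xi> \<longlonglongrightarrow> t"
  proof (rule tendsto_sandwich)
    have "t - \<Delta> n \<le> \<xi> n" "\<xi> n \<le> t + 2 * \<Delta> n" for n
      using \<xi>(1,2)[of n] u(2,3)[of n] by linarith+
    then show "eventually (\<lambda>n. t - \<Delta> n \<le> \<xi> n) sequentially"
        "eventually (\<lambda>n. \<xi> n \<le> t + 2 * \<Delta> n) sequentially"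
      by simp_all
    show "(\<lambda>n. t - \<Delta> n) \<longlonglongrightarrow> t" "(\<lambda>n. t + 2 * \<Delta> n) \<longlonglongrightarrow> t"
      using tendsto_diff[OF tendsto_const \<Delta>_lim, of t]
        tendsto_add[OF tendsto_const tendsto_mult[OF tendsto_const \<Delta>_lim], of t 2] by simp_all
  qed
  moreover have "\<xi> n \<ge> 0" for n using \<xi>(1)[of n] u(1)[of n] by simp
  ultimately have \<phi>\<xi>: "(\<lambda>n. \<phi> (\<xi> n)) \<longlonglongrightarrow> \<phi> t"
    using t by (intro continuous_on_tendsto_compose[OF \<phi>_cont, of \<xi> t]) auto
  from \<phi>\<xi> have "Bseq (\<lambda>n. \<phi> (\<xi> n))" by (intro convergent_imp_Bseq convergentI)
  then obtain B where B: "\<And>n. \<bar>\<phi> (\<xi> n)\<bar> \<le> B"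
    unfolding Bseq_def real_norm_def by blast

  have g: "\<bar>g n\<bar> \<le> a 0 * \<Delta> n" for n
  proof -
    obtain \<eta> where \<eta>: "0 < \<eta>" "\<eta> < \<Delta> n" "?G (\<Delta> n) - ?G 0 = (\<Delta> n - 0) * (- a \<eta>)"
      by (rule mean_value_half_line[OF G', of 0 "\<Delta> n"]) (use \<Delta>_pos in auto)
    have "g n = a \<eta> * \<Delta> n" using \<eta>(3) by (simp add: g_def algebra_simps)
    moreover have "0 \<le> a \<eta>" "a \<eta> \<le> a 0"
      using trawl_nonneg[OF trawl, of \<eta>] trawl_antimono[OF trawl, of 0 \<eta>] \<eta>(1) by auto
    ultimately show ?thesis using \<Delta>_pos[of n] by (simp add: abs_mult)
  qed

  have area: "measure lborel (A n k) = ?G 0" for n k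
    using measure_shifted_trawl_Int[OF trawl order_refl] by (simp add: A_def)
  have cov: "second_difference (A n) k (k - (l n + 1)) = - s n" if "k \<in> K n" for n k
  proof -
    have "k - (k - (l n + 1)) = l n + 1" using that by (simp add: K_def)
    then have "second_difference (A n) k (k - (l n + 1)) = 2 * ?G (real (l n + 1) * \<Delta> n)
      - ?G (real (l n + 1 + 1) * \<Delta> n) - ?G (\<bar>real (l n + 1) - 1\<bar> * \<Delta> n)"
      unfolding A_def by (subst second_difference_shifted_trawl[OF trawl \<Delta>_pos]) simp_all
    then show ?thesis by (simp add: s_def u_def algebra_simps)
  qed
  have var: "second_difference (A n) k k = 2 * g n" for n k
    unfolding A_def by (subst second_difference_shifted_trawl[OF trawl \<Delta>_pos]) (simp_all add: g_def)
  have K: "K n \<subseteq> {l n + 1..<n - 1}" for n by (auto simp: K_def)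
  have convex: "p \<in> A n j" if "i \<le> j" "j \<le> k" "p \<in> A n i" "p \<in> A n k" for n i j k p
    unfolding A_def
    using shifted_trawl_convex[OF trawl, of "real i * \<Delta> n" "real j * \<Delta> n" "real k * \<Delta> n" p] that \<Delta>_pos[of n]
    by (simp add: A_def)
  have fa: "finite_area (A n k)" for n k by (simp add: A_def finite_area_shifted_trawl[OF trawl])
  have T: "has_bochner_integral M (T n) (- real (card (K n)) * s n)"
    "integrable M (\<lambda>\<omega>. (T n \<omega> + real (card (K n)) * s n)\<^sup>2)"
    "expectation (\<lambda>\<omega>. (T n \<omega> + real (card (K n)) * s n)\<^sup>2)
      \<le> real (card (K n)) * (2 * (\<bar>\<kappa>\<bar> + 3 * ?G 0) * s n + 16 * (g n)\<^sup>2)" for n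
  proof -
    have "p \<in> A n j" if "i \<le> j" "j \<le> k" "k \<le> n - 1" "p \<in> A n i" "p \<in> A n k" for p i j k
      using convex[OF that(1,2,4,5)] .
    note increment_products[of "n - 1" "A n" "?G 0" "l n + 1" "K n" "s n" "g n", OF fa area this _ K cov var,
        simplified, folded T_def]
    then show "has_bochner_integral M (T n) (- real (card (K n)) * s n)"
      "integrable M (\<lambda>\<omega>. (T n \<omega> + real (card (K n)) * s n)\<^sup>2)"
      "expectation (\<lambda>\<omega>. (T n \<omega> + real (card (K n)) * s n)\<^sup>2)
      \<le> real (card (K n)) * (2 * (\<bar>\<kappa>\<bar> + 3 * ?G 0) * s n + 16 * (g n)\<^sup>2)"
      by (simp_all add: T_def[abs_def])
  qed

  \<comment> \<open>The estimator is split into its bias, which is deterministic, and its centred part.\<close>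
  define R where "R n \<omega> = (T n \<omega> + real (card (K n)) * s n) / (real n * (\<Delta> n)\<^sup>2)" for n \<omega>
  define e where "e n = \<phi> t - real (card (K n)) / real n * \<phi> (\<xi> n)" for n
  have Tm: "T n \<in> borel_measurable M" for n
    using T(1)[of n] by (auto simp: has_bochner_integral_iff intro: borel_measurable_integrable)
  have Rm: "R n \<in> borel_measurable M" for n unfolding R_def using Tm by simp

  have decomp: "trawl_deriv_estimator X n (\<Delta> n) t \<omega>
      = vector_derivative a (at t within {0..}) + R n \<omega> + e n" for n \<omega>
  proof -
    have "real (card (K n)) * s n / (real n * (\<Delta> n)\<^sup>2) = real (card (K n)) / real n * \<phi> (\<xi> n)"
      using \<Delta>_pos[of n] by (simp add: \<xi>(3))
    then show ?thesis unfolding deriv est R_def e_def by (simp add: add_divide_distrib)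
  qed

  have frac: "(\<lambda>n. real (card (K n)) / real n) \<longlonglongrightarrow> 1"
  proof (rule tendsto_sandwich)
    have "real (card (K n)) / real n \<le> 1" for n by (auto simp: K_def divide_le_eq_1)
    then show "eventually (\<lambda>n. real (card (K n)) / real n \<le> 1) sequentially" by simp
    \<comment> \<open>The sum has \<open>n - 2 - l n\<close> terms, or none, and \<open>l n \<le> t / \<Delta> n\<close> is negligible
      against \<open>n\<close> because the observation horizon tends to infinity.\<close>
    have "1 - 2 / real n - t / (real n * \<Delta> n) \<le> real (card (K n)) / real n" if "n > 0" for n
    proof -
      have "real n - 2 - real (l n) \<le> real (card (K n))" by (simp add: K_def)
      moreover have "real (l n) \<le> t / \<Delta> n" using u(2)[of n] \<Delta>_pos[of n] by (simp add: u_def field_simps)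
      ultimately have "real n - 2 - t / \<Delta> n \<le> real (card (K n))" by linarith
      then have "(real n - 2 - t / \<Delta> n) / real n \<le> real (card (K n)) / real n"
        by (rule divide_right_mono) simp
      then show ?thesis using that by (simp add: diff_divide_distrib mult.commute)
    qed
    then show "eventually (\<lambda>n. 1 - 2 / real n - t / (real n * \<Delta> n) \<le> real (card (K n)) / real n) sequentially"
      by (auto intro: eventually_mono[OF eventually_gt_at_top[of 0]])
    have "(\<lambda>n. t / (real n * \<Delta> n)) \<longlonglongrightarrow> 0"
      using tendsto_divide_0[OF tendsto_const filterlim_at_top_imp_at_infinity[OF horizon]] .
    moreover have "(\<lambda>n. 2 / real n) \<longlonglongrightarrow> 0"
      by (rule lim_const_over_n)
    ultimately have "(\<lambda>n. 1 - 2 / real n - t / (real n * \<Delta> n)) \<longlonglongrightarrow> 1 - 0 - 0"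
      by (intro tendsto_diff tendsto_const)
    then show "(\<lambda>n. 1 - 2 / real n - t / (real n * \<Delta> n)) \<longlonglongrightarrow> 1" by simp
  qed simp
  have "e \<longlonglongrightarrow> \<phi> t - 1 * \<phi> t"
    unfolding e_def by (intro tendsto_diff tendsto_mult tendsto_const frac \<phi>\<xi>)
  then have e: "e \<in> o(\<lambda>_. 1)" by (simp add: smalloI_tendsto)

  define C where "C = 2 * (\<bar>\<kappa>\<bar> + 3 * ?G 0) * B + 16 * (a 0)\<^sup>2"
  have G0: "0 \<le> ?G 0" using overlap_area_nonneg[OF trawl, of 0] by simp
  have "B \<ge> 0" using B[of 0] by linarith
  then have C0: "0 \<le> C" using G0 by (simp add: C_def)
  let ?r = "\<lambda>n. 1 / sqrt (real n * (\<Delta> n)\<^sup>2)"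
  \<comment> \<open>For \<open>n = 0\<close> both sides are 0, because division by 0 gives 0.\<close>
  have scaled: "(R n \<omega> / ?r n)\<^sup>2 = (T n \<omega> + real (card (K n)) * s n)\<^sup>2 / (real n * (\<Delta> n)\<^sup>2)" for n \<omega>
  proof -
    have "(R n \<omega> / ?r n)\<^sup>2 = (R n \<omega>)\<^sup>2 * (real n * (\<Delta> n)\<^sup>2)"
      by (simp add: power_mult_distrib)
    then show ?thesis
      by (cases "real n * (\<Delta> n)\<^sup>2 = 0") (auto simp: R_def power_divide power2_eq_square)
  qed
  have bound: "expectation (\<lambda>\<omega>. (R n \<omega> / ?r n)\<^sup>2) \<le> C" for n
  proof (cases "n = 0")
    case True
    then show ?thesis using C0 by simp
  next
    case False
    then have pos: "real n * (\<Delta> n)\<^sup>2 > 0" using \<Delta>_pos[of n] by simp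
    have sB: "s n \<le> (\<Delta> n)\<^sup>2 * B"
      unfolding \<xi>(3) using B[of n] by (intro mult_left_mono) auto
    have "(g n)\<^sup>2 \<le> (a 0 * \<Delta> n)\<^sup>2" using g[of n] by (rule abs_le_square_iff[THEN iffD1, OF order_trans]) simp
    then have gB: "(g n)\<^sup>2 \<le> (\<Delta> n)\<^sup>2 * (a 0)\<^sup>2" by (simp add: power_mult_distrib mult.commute)
    have "2 * (\<bar>\<kappa>\<bar> + 3 * ?G 0) * s n + 16 * (g n)\<^sup>2
        \<le> 2 * (\<bar>\<kappa>\<bar> + 3 * ?G 0) * ((\<Delta> n)\<^sup>2 * B) + 16 * ((\<Delta> n)\<^sup>2 * (a 0)\<^sup>2)"
      using G0 sB gB by (intro add_mono mult_left_mono) auto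
    also have "\<dots> = (\<Delta> n)\<^sup>2 * C" by (simp add: C_def algebra_simps)
    finally have "real (card (K n)) * (2 * (\<bar>\<kappa>\<bar> + 3 * ?G 0) * s n + 16 * (g n)\<^sup>2)
        \<le> real n * ((\<Delta> n)\<^sup>2 * C)"
      using C0 by (intro order_trans[OF mult_left_mono mult_right_mono]) (auto simp: K_def)
    with T(3)[of n] have "expectation (\<lambda>\<omega>. (T n \<omega> + real (card (K n)) * s n)\<^sup>2) \<le> (real n * (\<Delta> n)\<^sup>2) * C"
      by simp
    then show ?thesis unfolding scaled using pos by (simp add: divide_le_eq mult.commute)
  qed
  have "tight (\<lambda>n. distr M borel (\<lambda>\<omega>. R n \<omega> / ?r n))"
  proof (rule tight_of_bounded_second_moment)
    show "(\<lambda>\<omega>. R n \<omega> / ?r n) \<in> borel_measurable M" for n using Rm by simp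
    show "integrable M (\<lambda>\<omega>. (R n \<omega> / ?r n)\<^sup>2)" for n unfolding scaled using T(2)[of n] by simp
  qed (rule bound)
  then have "O_prob M R ?r" using Rm by (simp add: O_prob_def)
  then show "\<exists>R e. O_prob M R ?r \<and> e \<in> o(\<lambda>_. 1) \<and> (\<forall>n. \<forall>\<omega>\<in>space M.
      trawl_deriv_estimator X n (\<Delta> n) t \<omega> = vector_derivative a (at t within {0..}) + R n \<omega> + e n)"
    using e decomp by blast
qed

end
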